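(* Let $G$ be a group. Then the set $\mathcal{CO}(G)$ of Conradian left-preorders on $G$ is either finite or uncountable.
   Context: A left-preorder on a group $G$ is a binary relation $\preceq$ on $G$ that is total, transitive and reflexive, that is left-invariant ($\alpha_1\preceq\alpha_2$ implies $\alpha\alpha_1\preceq\alpha\alpha_2$ for all $\alpha,\alpha_1,\alpha_2\in G$), and that is not the trivial relation (the one with $\alpha_1\preceq\alpha_2$ for all $\alpha_1,\alpha_2\in G$). Write $\alpha\prec\beta$ if $\alpha\preceq\beta$ and not $\beta\preceq\alpha$. A left-preorder $\preceq$ is Conradian if for all $\alpha,\beta\in G$ with $1\prec\alpha$ and $1\prec\beta$ there is $n\in\mathbb{N}$ (where $0\in\mathbb N$) with $\alpha\prec\beta\alpha^n$. $\mathcal{CO}(G)$ denotes the set of all Conradian left-preorders on $G$. The empty set counts as finite. *)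

theory Defs
  imports "HOL-Algebra.Group" "HOL-Library.Countable_Set"
begin

text \<open>
  A binary relation on the group is a set of pairs from the carrier. The inclusion in
  \<open>carrier G \<times> carrier G\<close> is required explicitly: without it one preorder on the group would be
  represented by many sets, differing only outside the carrier. Note also that the library's
  \<open>total_on\<close> speaks about distinct elements only.
\<close>

definition left_preorder :: "('a, 'b) monoid_scheme \<Rightarrow> ('a \<times> 'a) set \<Rightarrow> bool" where
  "left_preorder G r \<longleftrightarrow>
     r \<subseteq> carrier G \<times> carrier G \<and>
     total_on (carrier G) r \<and> trans r \<and> refl_on (carrier G) r \<and>
     (\<forall>a\<in>carrier G. \<forall>a1\<in>carrier G. \<forall>a2\<in>carrier G.
        (a1, a2) \<in> r \<longrightarrow> (a \<otimes>\<^bsub>G\<^esub> a1, a \<otimes>\<^bsub>G\<^esub> a2) \<in> r) \<and>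
     r \<noteq> carrier G \<times> carrier G"

definition strict_part :: "('a \<times> 'a) set \<Rightarrow> ('a \<times> 'a) set" where
  "strict_part r = {(a, b). (a, b) \<in> r \<and> (b, a) \<notin> r}"

definition conradian :: "('a, 'b) monoid_scheme \<Rightarrow> ('a \<times> 'a) set \<Rightarrow> bool" where
  "conradian G r \<longleftrightarrow>
     (\<forall>a\<in>carrier G. \<forall>b\<in>carrier G.
        (\<one>\<^bsub>G\<^esub>, a) \<in> strict_part r \<longrightarrow> (\<one>\<^bsub>G\<^esub>, b) \<in> strict_part r \<longrightarrow>
        (\<exists>n::nat. (a, b \<otimes>\<^bsub>G\<^esub> (a [^]\<^bsub>G\<^esub> n)) \<in> strict_part r))"

definition conradian_left_preorders :: "('a, 'b) monoid_scheme \<Rightarrow> ('a \<times> 'a) set set" where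
  "conradian_left_preorders G = {r. left_preorder G r \<and> conradian G r}"

end

(* A preorder is encoded by its set of strictly positive elements. If a Conradian preorder on G has
   an infinite chain of convex subgroups, then the signs on infinitely many disjoint annuli can be
   flipped independently, which gives uncountably many Conradian preorders. So suppose that there are only
   countably many. Then every Conradian preorder has a largest proper convex subgroup N. By Hoelder's
   argument G/N is abelian and Archimedean ordered, and if two such N differ, or if two orders on G/N
   differ by more than a sign, then some abelian quotient of G has rank at least 2, hence a cone for every
   real slope. Therefore N does not depend on the preorder and Conradian preorders on G are given by a
   sign and a Conradian (or trivial) preorder on N. If there are infinitely many on G, there are infinitely
   many on N, and iterating produces an infinite descending chain of convex subgroups. *)

theory Submission
  imports Defs "HOL-Algebra.Generated_Groups" "HOL-Analysis.Continuum_Not_Denumerable"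
begin

text \<open>All cones live on subgroups \<open>H\<close> of one fixed group, so the passage to a
  convex subgroup can be iterated without changing the type. Encoding orders by positive elements
  makes gluing a union of sets and lets the trivial preorder appear as the empty set.

  The obstacle is that the Conrad condition a \<prec> b a^n is asymmetric: the powers stand on the
  right, while the order is only left-invariant. So it is not evident that reversing or gluing
  orders preserves it, and flipping signs does both. The remedy is a uniform exponent: n = 2 already
  works, even for some b that are not positive (\<open>conrad_square\<close>).

  Convex subgroups are not known to be normal in advance. Hoelder's argument therefore runs without
  quotients, on the preorder itself, with the residue in the role of the identity. Only when a
  subgroup is known to contain all commutators is a quotient formed, and it serves to show that two
  independent elements give uncountably many cones: each real r yields the half-plane a + r b > 0 in
  Z^2, and a rational between two slopes tells their cones apart.\<close>

context group
begin

lemma inv_mult_cancel [simp]: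
  assumes "x \<in> carrier G" "y \<in> carrier G"
  shows "inv x \<otimes> (x \<otimes> y) = y" "x \<otimes> (inv x \<otimes> y) = y"
  using assms by (simp_all flip: m_assoc)

lemma subgroup_nat_pow_closed:
  assumes "subgroup K G" "x \<in> K"
  shows "x [^] (n::nat) \<in> K"
  using assms by (induction n) (auto intro: subgroup.one_closed subgroup.m_closed)

lemma subgroup_mult_left_iff:
  assumes "subgroup K G" "k \<in> K" "x \<in> carrier G"
  shows "k \<otimes> x \<in> K \<longleftrightarrow> x \<in> K"
proof
  assume "k \<otimes> x \<in> K"
  then have "inv k \<otimes> (k \<otimes> x) \<in> K"
    using assms by (auto intro: subgroup.m_closed subgroup.m_inv_closed)
  then show "x \<in> K"
    using assms subgroup.mem_carrier[OF assms(1)] by simp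
qed (use assms in \<open>auto intro: subgroup.m_closed\<close>)

lemma subgroup_mult_right_iff:
  assumes "subgroup K G" "k \<in> K" "x \<in> carrier G"
  shows "x \<otimes> k \<in> K \<longleftrightarrow> x \<in> K"
proof
  assume "x \<otimes> k \<in> K"
  then have "x \<otimes> k \<otimes> inv k \<in> K"
    using assms by (blast intro: subgroup.m_closed subgroup.m_inv_closed)
  then show "x \<in> K"
    using assms subgroup.mem_carrier[OF assms(1)] by (simp add: m_assoc)
qed (use assms in \<open>auto intro: subgroup.m_closed\<close>)

lemma subgroup_inv_iff:
  assumes "subgroup K G" "x \<in> carrier G"
  shows "inv x \<in> K \<longleftrightarrow> x \<in> K"
  using assms by (metis inv_inv subgroup.m_inv_closed)

end

section \<open>Strict cones and their convex subgroups\<close>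

text \<open>\<open>Q\<close> is the set of strictly positive elements of a left-preorder on \<open>H\<close>: there
  \<open>x \<prec> y\<close> means \<open>x\<inverse> y \<in> Q\<close>, and \<open>H - Q\<close> consists of the elements \<open>\<preceq> 1\<close>.\<close>

locale strict_cone = group G for G (structure) +
  fixes H Q
  assumes subgroup_H: "subgroup H G"
    and Q_subset: "Q \<subseteq> H"
    and Q_nonempty: "Q \<noteq> {}"
    and asym: "a \<in> Q \<Longrightarrow> inv a \<notin> Q"
    and compl_closed: "a \<in> H \<Longrightarrow> a \<notin> Q \<Longrightarrow> b \<in> H \<Longrightarrow> b \<notin> Q \<Longrightarrow> a \<otimes> b \<notin> Q"
begin

definition less (infix "\<prec>" 50) where "x \<prec> y \<longleftrightarrow> inv x \<otimes> y \<in> Q"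

text \<open>The elements equivalent to 1. By the third clause of \<open>convex\<close>, every convex
  subgroup contains them, so this is the least one.\<close>

definition residue where "residue = {h \<in> H. h \<notin> Q \<and> inv h \<notin> Q}"

text \<open>Given that the residue lies in K (third clause), the last clause is the usual interval
  condition: applied to the inverse of k it says that a positive element outside K exceeds every k
  in K. This multiplicative form is the one needed to compute signs of products.\<close>

definition convex where
  "convex K \<longleftrightarrow> subgroup K G \<and> K \<subseteq> H \<and> (\<forall>a\<in>H - K. a \<in> Q \<or> inv a \<in> Q) \<and>
     (\<forall>a\<in>Q - K. \<forall>k\<in>K. k \<otimes> a \<in> Q)"

lemma carrierI [simp]: "x \<in> H \<Longrightarrow> x \<in> carrier G"
  using subgroup_H by (rule subgroup.mem_carrier)

lemma QI [simp]: "x \<in> Q \<Longrightarrow> x \<in> H"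
  using Q_subset by blast

lemma closed [simp]:
  "x \<in> H \<Longrightarrow> y \<in> H \<Longrightarrow> x \<otimes> y \<in> H"
  "x \<in> H \<Longrightarrow> inv x \<in> H"
  "\<one> \<in> H"
  "x \<in> H \<Longrightarrow> x [^] (n::nat) \<in> H"
  "x \<in> H \<Longrightarrow> x [^] (m::int) \<in> H"
  using subgroup_H subgroup_nat_pow_closed subgroup_int_pow_closed
  by (auto intro: subgroup.m_closed subgroup.m_inv_closed subgroup.one_closed)

lemma one_notin [simp]: "\<one> \<notin> Q"
  using asym[of \<one>] by auto

lemma mult_right: "a \<otimes> c \<in> Q" if "a \<in> Q" "c \<in> H" "inv c \<notin> Q"
  using compl_closed[of "a \<otimes> c" "inv c"] that by (auto simp: m_assoc)

lemma mult_left: "c \<otimes> a \<in> Q" if "a \<in> Q" "c \<in> H" "inv c \<notin> Q"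
  using compl_closed[of "inv c" "c \<otimes> a"] that by auto

lemma mult_closed: "a \<in> Q \<Longrightarrow> b \<in> Q \<Longrightarrow> a \<otimes> b \<in> Q"
  by (simp add: asym mult_right)

lemma pow_closed: "a \<in> Q \<Longrightarrow> n > 0 \<Longrightarrow> a [^] (n::nat) \<in> Q"
proof (induction n)
  case (Suc n)
  then show ?case
    by (cases "n = 0") (auto intro: mult_closed)
qed simp

lemma less_irrefl: "x \<in> H \<Longrightarrow> \<not> x \<prec> x"
  by (simp add: less_def)

lemma inv_diff: "x \<in> H \<Longrightarrow> y \<in> H \<Longrightarrow> inv (inv x \<otimes> y) = inv y \<otimes> x"
  by (simp add: inv_mult_group)

lemma less_trans: "x \<prec> z" if "x \<prec> y" "y \<prec> z" "x \<in> H" "y \<in> H" "z \<in> H"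
  using mult_closed[of "inv x \<otimes> y" "inv y \<otimes> z"] that by (simp add: less_def m_assoc)

lemma less_le_trans: "x \<prec> z" if "x \<prec> y" "\<not> z \<prec> y" "x \<in> H" "y \<in> H" "z \<in> H"
  using mult_right[of "inv x \<otimes> y" "inv y \<otimes> z"] that by (simp add: less_def m_assoc inv_diff)

lemma le_trans: "\<not> z \<prec> x" if "\<not> y \<prec> x" "\<not> z \<prec> y" "x \<in> H" "y \<in> H" "z \<in> H"
  using compl_closed[of "inv z \<otimes> y" "inv y \<otimes> x"] that by (simp add: less_def m_assoc)

lemma less_mult_left: "g \<otimes> x \<prec> g \<otimes> y \<longleftrightarrow> x \<prec> y" if "g \<in> H" "x \<in> H" "y \<in> H"
  using that by (simp add: less_def m_assoc inv_mult_group)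

lemma less_mult: "x \<prec> x \<otimes> a" if "a \<in> Q" "x \<in> H"
  using that by (simp add: less_def)

text \<open>Under left-invariance alone, c x \<preceq> x does not amount to c \<preceq> 1. It can
  still be iterated, since multiplying it by c^n on the left is allowed.\<close>

lemma pow_le:
  assumes "c \<in> H" "x \<in> H" "\<not> x \<prec> c \<otimes> x"
  shows "\<not> x \<prec> c [^] (n::nat) \<otimes> x"
proof (induction n)
  case 0
  then show ?case using assms by (simp add: less_irrefl)
next
  case (Suc n)
  have "\<not> c [^] n \<otimes> x \<prec> c [^] n \<otimes> (c \<otimes> x)"
    using assms by (simp add: less_mult_left)
  then have "\<not> x \<prec> c [^] n \<otimes> (c \<otimes> x)"
    using Suc assms le_trans[of "c [^] n \<otimes> x" "c [^] n \<otimes> (c \<otimes> x)" x] by simp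
  then show ?case using assms by (simp add: m_assoc)
qed

lemma convexD:
  assumes "convex K"
  shows "subgroup K G" "K \<subseteq> H" "a \<in> H \<Longrightarrow> a \<notin> K \<Longrightarrow> a \<in> Q \<or> inv a \<in> Q"
    "a \<in> Q \<Longrightarrow> a \<notin> K \<Longrightarrow> k \<in> K \<Longrightarrow> k \<otimes> a \<in> Q"
  using assms by (auto simp: convex_def)

text \<open>Passing to inverses turns right multiplication into left multiplication: if a k were
  negative, then k (a k)^-1 = a^-1 would be positive.\<close>

lemma convex_mult_right:
  assumes K: "convex K" and a: "a \<in> Q" "a \<notin> K" and k: "k \<in> K"
  shows "a \<otimes> k \<in> Q"
proof (rule ccontr)
  note [simp] = convexD(1)[OF K]
  have kH [simp]: "k \<in> H" using convexD(2)[OF K] k by blast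
  assume "a \<otimes> k \<notin> Q"
  moreover have ak: "a \<otimes> k \<notin> K"
    using a k by (simp add: subgroup_mult_right_iff)
  ultimately have "inv (a \<otimes> k) \<in> Q"
    using convexD(3)[OF K, of "a \<otimes> k"] a by auto
  moreover have "inv (a \<otimes> k) \<notin> K"
    using ak a by (simp add: subgroup_inv_iff)
  ultimately have "k \<otimes> inv (a \<otimes> k) \<in> Q"
    using convexD(4)[OF K] k by blast
  then show False
    using asym[OF a(1)] a by (simp add: inv_mult_group)
qed

lemma convex_residue: "convex residue"
  unfolding convex_def
proof (intro conjI ballI)
  show "subgroup residue G"
  proof (rule subgroupI)
    have "\<one> \<in> residue"
      by (simp add: residue_def)
    then show "residue \<noteq> {}"
      by blast
  qed (auto simp: residue_def inv_mult_group compl_closed)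
qed (auto simp: residue_def intro: mult_left)

lemma annulus_nonempty:
  assumes K: "convex K" "K \<noteq> H"
  obtains a where "a \<in> Q" "a \<notin> K"
proof -
  obtain a where a: "a \<in> H" "a \<notin> K"
    using convexD(2)[OF K(1)] K(2) by blast
  then show ?thesis
    using convexD(3)[OF K(1) a] subgroup_inv_iff[OF convexD(1)[OF K(1)], of a] that by auto
qed

text \<open>If a b were in K, multiplying a on the left by (a b)^-1 would make b^-1
  positive.\<close>

lemma annulus_mult_closed:
  assumes K: "convex K" and a: "a \<in> Q" "a \<notin> K" and b: "b \<in> Q" "b \<notin> K"
  shows "a \<otimes> b \<in> Q \<and> a \<otimes> b \<notin> K"
proof
  show "a \<otimes> b \<in> Q" using a b by (simp add: mult_closed)
  show "a \<otimes> b \<notin> K"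
  proof
    assume "a \<otimes> b \<in> K"
    then have "inv (a \<otimes> b) \<otimes> a \<in> Q"
      using convexD(4)[OF K a] subgroup.m_inv_closed[OF convexD(1)[OF K]] by blast
    then show False
      using asym[OF b(1)] a b by (simp add: inv_mult_group m_assoc)
  qed
qed

end

section \<open>The Conrad property under reversal and restriction\<close>

locale conrad_cone = strict_cone +
  assumes conrad: "a \<in> Q \<Longrightarrow> b \<in> Q \<Longrightarrow> \<exists>n::nat. inv a \<otimes> (b \<otimes> a [^] n) \<in> Q"

lemma (in group) conrad_coneI:
  assumes "subgroup H G" "Q \<subseteq> H" "Q \<noteq> {}"
    and "\<And>a. a \<in> Q \<Longrightarrow> inv a \<notin> Q"
    and "\<And>a b. a \<in> H \<Longrightarrow> a \<notin> Q \<Longrightarrow> b \<in> H \<Longrightarrow> b \<notin> Q \<Longrightarrow> a \<otimes> b \<notin> Q"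
    and "\<And>a b. a \<in> Q \<Longrightarrow> b \<in> Q \<Longrightarrow> \<exists>n::nat. inv a \<otimes> (b \<otimes> a [^] n) \<in> Q"
  shows "conrad_cone G H Q"
  unfolding conrad_cone_def conrad_cone_axioms_def strict_cone_def strict_cone_axioms_def
  using assms is_group by auto

context conrad_cone
begin

text \<open>Exponent 2 suffices. Put c = b a. If c a \<preceq> a, then c^n \<prec> a for all n,
  hence b c^n \<prec> b a = c for all n. This contradicts the Conrad property of c with b, or of c
  with b c, whichever of these is positive. The second alternative is there for b in a convex
  subgroup not containing a, where b may have any sign.\<close>

lemma conrad_square:
  assumes a: "a \<in> Q" and b: "b \<in> H" "b \<otimes> a \<in> Q" "b \<in> Q \<or> b \<otimes> (b \<otimes> a) \<in> Q"
  shows "inv a \<otimes> (b \<otimes> (a \<otimes> a)) \<in> Q"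
proof (rule ccontr)
  define c where "c = b \<otimes> a"
  have [simp]: "a \<in> H" "b \<in> H" "c \<in> H" using a b by (auto simp: c_def)
  have cQ: "c \<in> Q" using b by (simp add: c_def)
  assume "inv a \<otimes> (b \<otimes> (a \<otimes> a)) \<notin> Q"
  then have "\<not> a \<prec> c \<otimes> a"
    by (simp add: less_def c_def m_assoc)
  then have le: "\<not> a \<prec> c [^] n \<otimes> a" for n :: nat
    by (rule pow_le[rotated 2]) auto
  have lt: "c [^] n \<prec> a" for n :: nat
    using less_le_trans[OF less_mult[OF a, of "c [^] n"] le[of n]] by simp
  then have not: "\<not> c \<prec> b \<otimes> c [^] n" for n :: nat
    using less_mult_left[of b a "c [^] n"] less_trans[of a "c [^] n" a] less_irrefl[of a]
    by (auto simp: c_def)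
  from b(3) show False
  proof
    assume "b \<in> Q"
    then show False
      using conrad[OF cQ, of b] not by (auto simp: less_def)
  next
    assume "b \<otimes> (b \<otimes> a) \<in> Q"
    then have "b \<otimes> c \<in> Q" by (simp add: c_def)
    then obtain n :: nat where "inv c \<otimes> (b \<otimes> c \<otimes> c [^] n) \<in> Q"
      using conrad[OF cQ] by blast
    moreover have "b \<otimes> c \<otimes> c [^] n = b \<otimes> c [^] Suc n"
      using nat_pow_Suc2[of c n] by (simp add: m_assoc del: nat_pow_Suc)
    ultimately show False
      using not[of "Suc n"] by (simp add: less_def del: nat_pow_Suc)
  qed
qed

text \<open>Gluing needs a witness that is positive and also stays outside K, so that no inner order
  can change its sign. Exponent 2 gives t > 1; should t fall into K, exponent 3 gives t a, which is
  outside.\<close>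

lemma conrad_annulus:
  assumes K: "convex K" and a: "a \<in> Q" "a \<notin> K" and b: "b \<in> K \<or> b \<in> Q"
  shows "\<exists>n::nat. inv a \<otimes> (b \<otimes> a [^] n) \<in> Q \<and> inv a \<otimes> (b \<otimes> a [^] n) \<notin> K"
proof -
  have [simp]: "a \<in> H" "b \<in> H" using a b convexD(2)[OF K] by auto
  define t where "t = inv a \<otimes> (b \<otimes> (a \<otimes> a))"
  have "b \<otimes> a \<in> Q" "b \<in> Q \<or> b \<otimes> (b \<otimes> a) \<in> Q"
    using b a convexD(4)[OF K] subgroup_mult_left_iff[OF convexD(1)[OF K]]
    by (auto intro: mult_closed)
  then have t: "t \<in> Q"
    unfolding t_def using a by (intro conrad_square) auto
  have t2: "inv a \<otimes> (b \<otimes> a [^] (2::nat)) = t"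
    by (simp add: t_def numeral_2_eq_2 m_assoc)
  have t3: "inv a \<otimes> (b \<otimes> a [^] (3::nat)) = t \<otimes> a"
    by (simp add: t_def numeral_3_eq_3 m_assoc)
  show ?thesis
  proof (cases "t \<in> K")
    case True
    then have "t \<otimes> a \<in> Q \<and> t \<otimes> a \<notin> K"
      using a convexD(4)[OF K] subgroup_mult_left_iff[OF convexD(1)[OF K], of t a] by auto
    then show ?thesis using t3 by metis
  next
    case False
    then show ?thesis using t t2 by metis
  qed
qed

lemma reverse_conrad_cone: "conrad_cone G H {h \<in> H. inv h \<in> Q}"
proof (rule conrad_coneI)
  show "subgroup H G" by (rule subgroup_H)
  obtain q where "q \<in> Q" using Q_nonempty by blast
  then have "inv q \<in> {h \<in> H. inv h \<in> Q}" by simp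
  then show "{h \<in> H. inv h \<in> Q} \<noteq> {}" by blast
  show "inv a \<notin> {h \<in> H. inv h \<in> Q}" if "a \<in> {h \<in> H. inv h \<in> Q}" for a
    using that asym[of "inv a"] by auto
  show "a \<otimes> b \<notin> {h \<in> H. inv h \<in> Q}"
    if "a \<in> H" "a \<notin> {h \<in> H. inv h \<in> Q}" "b \<in> H" "b \<notin> {h \<in> H. inv h \<in> Q}" for a b
    using that compl_closed[of "inv b" "inv a"] by (auto simp: inv_mult_group)
  show "\<exists>n::nat. inv a \<otimes> (b \<otimes> a [^] n) \<in> {h \<in> H. inv h \<in> Q}"
    if "a \<in> {h \<in> H. inv h \<in> Q}" "b \<in> {h \<in> H. inv h \<in> Q}" for a b
  proof (rule ccontr)
    define u where "u = inv a"
    define v where "v = inv b"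
    have [simp]: "u \<in> H" "v \<in> H" and Q: "u \<in> Q" "v \<in> Q" and ab: "a = inv u" "b = inv v"
      using that by (auto simp: u_def v_def)
    assume "\<not> ?thesis"
    then have *: "u [^] n \<otimes> (v \<otimes> inv u) \<notin> Q" for n :: nat
      using ab by (auto simp: inv_mult_group m_assoc simp flip: nat_pow_inv)
    \<comment> \<open>In terms of the positive elements u and v, some u^n v u^-1 has to be positive.
      This z is chosen so that u^-1 z u^2 = v^-1: were z positive, \<open>conrad_square\<close>
      would make v^-1 positive. Hence z^-1 = u^2 v u^-1 is at least 1, and one more factor u makes
      it strictly positive, so n = 3.\<close>
    define z where "z = u \<otimes> (inv v \<otimes> (inv u \<otimes> inv u))"
    have [simp]: "z \<in> H" by (simp add: z_def)
    have iz: "inv z = u \<otimes> (u \<otimes> (v \<otimes> inv u))"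
      by (simp add: z_def inv_mult_group m_assoc)
    have "z \<notin> Q"
    proof
      assume "z \<in> Q"
      then have "inv u \<otimes> (z \<otimes> (u \<otimes> u)) \<in> Q"
        using Q by (intro conrad_square) (auto intro: mult_closed)
      then have "inv v \<in> Q" by (simp add: z_def m_assoc)
      then show False using asym Q by blast
    qed
    then have "u \<otimes> inv z \<in> Q"
      using Q by (intro mult_right) auto
    then show False
      using *[of 3] by (simp add: iz numeral_3_eq_3 m_assoc)
  qed
qed auto

lemma reverse_convex:
  assumes K: "convex K"
  shows "strict_cone.convex G H {h \<in> H. inv h \<in> Q} K"
proof -
  interpret R: conrad_cone G H "{h \<in> H. inv h \<in> Q}" by (rule reverse_conrad_cone)
  note R.QI [simp del] \<comment> \<open>loops: its premise unfolds to a statement containing its conclusion\<close>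
  show ?thesis
    unfolding R.convex_def
  proof (intro conjI ballI)
    fix a k assume a: "a \<in> {h \<in> H. inv h \<in> Q} - K" and k: "k \<in> K"
    then have kH: "k \<in> H" using convexD(2)[OF K] by blast
    have "inv a \<otimes> inv k \<in> Q"
    proof (rule convex_mult_right[OF K])
      show "inv a \<notin> K"
        using a subgroup_inv_iff[OF convexD(1)[OF K], of a] by auto
      show "inv k \<in> K"
        using k by (rule subgroup.m_inv_closed[OF convexD(1)[OF K]])
    qed (use a in auto)
    then show "k \<otimes> a \<in> {h \<in> H. inv h \<in> Q}"
      using a kH by (auto simp: inv_mult_group)
  qed (use convexD[OF K] in auto)
qed

lemma restrict_conrad_cone:
  assumes K: "subgroup K G" "K \<subseteq> H" "Q \<inter> K \<noteq> {}"
  shows "conrad_cone G K (Q \<inter> K)"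
proof (rule conrad_coneI)
  fix a b assume ab: "a \<in> Q \<inter> K" "b \<in> Q \<inter> K"
  then obtain n :: nat where "inv a \<otimes> (b \<otimes> a [^] n) \<in> Q"
    using conrad by blast
  moreover have "inv a \<otimes> (b \<otimes> a [^] n) \<in> K"
    using ab K(1) by (auto intro!: subgroup.m_closed subgroup.m_inv_closed subgroup_nat_pow_closed)
  ultimately show "\<exists>n::nat. inv a \<otimes> (b \<otimes> a [^] n) \<in> Q \<inter> K" by blast
next
  show "a \<otimes> b \<notin> Q \<inter> K" if "a \<in> K" "a \<notin> Q \<inter> K" "b \<in> K" "b \<notin> Q \<inter> K" for a b
    using that K(2) compl_closed[of a b] by blast
qed (use K asym in auto)

lemma restrict_convex:
  assumes K: "subgroup K G" "K \<subseteq> H" "Q \<inter> K \<noteq> {}" and L: "convex L" "L \<subseteq> K"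
  shows "strict_cone.convex G K (Q \<inter> K) L"
proof -
  interpret R: conrad_cone G K "Q \<inter> K" by (rule restrict_conrad_cone[OF K])
  note R.QI [simp del]
  note L' = convexD[OF L(1)]
  show ?thesis
    unfolding R.convex_def
  proof (intro conjI ballI)
    show "a \<in> Q \<inter> K \<or> inv a \<in> Q \<inter> K" if "a \<in> K - L" for a
      using that L'(3)[of a] K(2) subgroup.m_inv_closed[OF K(1)] by blast
    show "k \<otimes> a \<in> Q \<inter> K" if "a \<in> Q \<inter> K - L" "k \<in> L" for a k
      using that L'(4)[of a k] L(2) subgroup.m_closed[OF K(1)] by blast
  qed (use L' L(2) in auto)
qed

end

section \<open>Gluing orders along nested convex subgroups\<close>

text \<open>An element takes its sign from the annulus \<open>U i - L i\<close> that contains it;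
  the elements in all \<open>L i\<close> become the residue. In a product of elements of different
  annuli the outer factor decides, because the inner one lies in the convex subgroup
  \<open>L i\<close> of the outer annulus. Hence the orders \<open>Q i\<close> need not be
  compatible with each other.\<close>

lemma (in group) lex_conrad_cone:
  fixes U L Q :: "'i \<Rightarrow> 'a set"
  assumes H: "subgroup H G" and I: "I \<noteq> {}"
    and cone: "\<And>i. i \<in> I \<Longrightarrow> conrad_cone G (U i) (Q i)"
    and conv: "\<And>i. i \<in> I \<Longrightarrow> strict_cone.convex G (U i) (Q i) (L i)"
    and proper: "\<And>i. i \<in> I \<Longrightarrow> L i \<noteq> U i"
    and sub: "\<And>i. i \<in> I \<Longrightarrow> U i \<subseteq> H"
    and nested: "\<And>i j. i \<in> I \<Longrightarrow> j \<in> I \<Longrightarrow> i \<noteq> j \<Longrightarrow> U i \<subseteq> L j \<or> U j \<subseteq> L i"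
    and cover: "\<And>h. h \<in> H \<Longrightarrow> (\<forall>i\<in>I. h \<in> L i) \<or> (\<exists>i\<in>I. h \<in> U i - L i)"
  shows "conrad_cone G H (\<Union>i\<in>I. Q i - L i)"
proof -
  define S where "S i = Q i - L i" for i
  define R where "R = (\<Union>i\<in>I. S i)"
  note scone = conrad_cone.axioms(1)[OF cone]
  note convexD = strict_cone.convexD[OF scone conv]
  have Lsub: "subgroup (L i) G" if "i \<in> I" for i using convexD(1) that by blast
  have LU: "L i \<subseteq> U i" if "i \<in> I" for i using convexD(2) that by blast
  have SU: "a \<in> U i" "a \<notin> L i" if "i \<in> I" "a \<in> S i" for a i
    using that strict_cone.Q_subset[OF scone] by (auto simp: S_def)
  have Uinv: "inv a \<in> U i" if "i \<in> I" "a \<in> U i" for a i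
    using that strict_cone.closed(2)[OF scone] by auto
  have SH: "a \<in> H" if "i \<in> I" "a \<in> S i" for a i
    using SU that sub by blast
  have Hc [simp]: "a \<in> carrier G" if "a \<in> H" for a
    using that subgroup.mem_carrier[OF H] by blast
  have Linv: "inv a \<in> L i \<longleftrightarrow> a \<in> L i" if "i \<in> I" "a \<in> carrier G" for a i
    using subgroup_inv_iff[OF Lsub] that by blast
  have S1: "a \<in> S i \<or> inv a \<in> S i" if "i \<in> I" "a \<in> U i" "a \<notin> L i" for a i
  proof -
    have "a \<in> carrier G" using sub[OF that(1)] that(2) by auto
    then show ?thesis
      using convexD(3)[OF that(1,1) that(2,3)] that Linv[OF that(1), of a] by (auto simp: S_def)
  qed
  have S2: "k \<otimes> a \<in> S i" if "i \<in> I" "a \<in> S i" "k \<in> L i" for a k i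
    using convexD(4)[OF that(1,1), of a k] that subgroup_mult_left_iff[OF Lsub] SH by (auto simp: S_def)
  have S3: "a \<otimes> k \<in> S i" if "i \<in> I" "a \<in> S i" "k \<in> L i" for a k i
    using strict_cone.convex_mult_right[OF scone[OF that(1)] conv[OF that(1)], of a k] that
      subgroup_mult_right_iff[OF Lsub] SH by (auto simp: S_def)
  have S4: "a \<otimes> b \<in> S i" if "i \<in> I" "a \<in> S i" "b \<in> S i" for a b i
    using strict_cone.annulus_mult_closed[OF scone[OF that(1)] conv[OF that(1)], of a b] that by (auto simp: S_def)
  have S5: "inv a \<notin> S i" if "i \<in> I" "a \<in> S i" for a i
    using strict_cone.asym[OF scone] that by (auto simp: S_def)
  have S6: "\<exists>n::nat. inv a \<otimes> (b \<otimes> a [^] n) \<in> S i" if "i \<in> I" "a \<in> S i" "b \<in> S i \<or> b \<in> L i" for a b i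
    using conrad_cone.conrad_annulus[OF cone[OF that(1)] conv[OF that(1)], of a b] that by (auto simp: S_def)
  have R1: "a \<otimes> b \<in> R" if ab: "a \<in> R" "b \<in> R" for a b
  proof -
    obtain i j where ij: "i \<in> I" "a \<in> S i" "j \<in> I" "b \<in> S j"
      using ab by (auto simp: R_def)
    consider "i = j" | "U i \<subseteq> L j" | "U j \<subseteq> L i" using nested ij by blast
    then have "a \<otimes> b \<in> S i \<or> a \<otimes> b \<in> S j"
    proof cases
      case 1
      then show ?thesis using S4[of i a b] ij by simp
    next
      case 2
      then show ?thesis using S2[of j b a] SU(1)[OF ij(1,2)] ij by auto
    next
      case 3
      then show ?thesis using S3[of i a b] SU(1)[OF ij(3,4)] ij by auto
    qed
    then show ?thesis using ij by (auto simp: R_def)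
  qed
  have R2: "inv a \<notin> R" if a: "a \<in> R" for a
  proof
    assume "inv a \<in> R"
    then obtain i j where ij: "i \<in> I" "a \<in> S i" "j \<in> I" "inv a \<in> S j"
      using a by (auto simp: R_def)
    have "i \<noteq> j" using S5 ij by blast
    then consider "U i \<subseteq> L j" | "U j \<subseteq> L i" using nested ij by blast
    then show False
    proof cases
      case 1
      then show ?thesis
        using SU(2)[OF ij(3,4)] Uinv[OF ij(1) SU(1)[OF ij(1,2)]] by auto
    next
      case 2
      then show ?thesis
        using SU[OF ij(1,2)] SU(1)[OF ij(3,4)] Linv[OF ij(1), of a] SH[OF ij(1,2)] by auto
    qed
  qed
  have R3: "x \<in> R \<or> inv x \<in> R \<or> (\<forall>i\<in>I. x \<in> L i)" if "x \<in> H" for x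
    using cover[OF that] S1 unfolding R_def by blast
  have R4: "a \<otimes> k \<in> R" "k \<otimes> a \<in> R" if "a \<in> R" "\<forall>i\<in>I. k \<in> L i" for a k
    using that unfolding R_def by (blast intro: S2 S3)+
  have "conrad_cone G H R"
  proof (rule conrad_coneI)
    show "subgroup H G" by (rule H)
    show "R \<subseteq> H" using SH by (auto simp: R_def)
    show "R \<noteq> {}"
    proof -
      obtain i where i: "i \<in> I" using I by blast
      then obtain a where "a \<in> U i" "a \<notin> L i" using LU proper by blast
      then show ?thesis using S1[OF i] i unfolding R_def by blast
    qed
    show "inv a \<notin> R" if "a \<in> R" for a using R2 that .
    show "a \<otimes> b \<notin> R" if ab: "a \<in> H" "a \<notin> R" "b \<in> H" "b \<notin> R" for a b
    proof
      assume "a \<otimes> b \<in> R"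
      then have not: "inv b \<otimes> inv a \<notin> R"
        using R2 ab by (metis Hc inv_mult_group)
      have linv: "\<forall>i\<in>I. inv x \<in> L i" if "\<forall>i\<in>I. x \<in> L i" for x
        using that by (simp add: subgroup.m_inv_closed[OF Lsub])
      \<comment> \<open>The inverse of an element that is not positive is positive or lies in every
        \<open>L i\<close>. So either b^-1 a^-1 is positive, which asymmetry has excluded, or a b
        lies in every \<open>L i\<close> and has no sign.\<close>
      consider "inv a \<in> R" "inv b \<in> R" | "inv a \<in> R" "\<forall>i\<in>I. b \<in> L i"
        | "inv b \<in> R" "\<forall>i\<in>I. a \<in> L i" | "\<forall>i\<in>I. a \<in> L i" "\<forall>i\<in>I. b \<in> L i"
        using R3 ab by blast
      then show False
      proof cases
        case 4
        then have "\<forall>i\<in>I. a \<otimes> b \<in> L i"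
          by (simp add: subgroup.m_closed[OF Lsub])
        then show False using \<open>a \<otimes> b \<in> R\<close> by (auto simp: R_def S_def)
      next
        case 1
        then show False using not R1[of "inv b" "inv a"] by blast
      next
        case 2
        then show False using not R4(2)[of "inv a" "inv b"] linv[of b] by blast
      next
        case 3
        then show False using not R4(1)[of "inv b" "inv a"] linv[of a] by blast
      qed
    qed
    show "\<exists>n::nat. inv a \<otimes> (b \<otimes> a [^] n) \<in> R" if ab: "a \<in> R" "b \<in> R" for a b
    proof -
      obtain i j where ij: "i \<in> I" "a \<in> S i" "j \<in> I" "b \<in> S j"
        using ab by (auto simp: R_def)
      \<comment> \<open>If b lies further out than a, then a^-1 b has the sign of b and n = 0 works.
        Otherwise b is in the annulus of a or in the subgroup below it, which is what
        \<open>conrad_annulus\<close> covers.\<close>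
      consider "i = j" | "U i \<subseteq> L j" | "U j \<subseteq> L i" using nested ij by blast
      then show ?thesis
      proof cases
        case 2
        then have "inv a \<otimes> b \<in> S j"
          using S2[OF ij(3,4), of "inv a"] Uinv[OF ij(1) SU(1)[OF ij(1,2)]] by auto
        then have "inv a \<otimes> (b \<otimes> a [^] (0::nat)) \<in> R"
          using ij SH by (auto simp: R_def)
        then show ?thesis by blast
      next
        case 1
        then show ?thesis using S6[OF ij(1,2), of b] ij unfolding R_def by blast
      next
        case 3
        then have "b \<in> L i" using SU(1)[OF ij(3,4)] by auto
        then show ?thesis using S6[OF ij(1,2), of b] ij unfolding R_def by blast
      qed
    qed
  qed
  then show ?thesis by (simp add: R_def S_def)
qed

context group
begin

definition conrad_cones :: "'a set \<Rightarrow> 'a set set" where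
  "conrad_cones H = {Q. conrad_cone G H Q}"

text \<open>Gluing with two annuli: H without K, signed by Q, and K without the residue of R, signed
  by R.\<close>

lemma replace_conrad_cone:
  assumes Q: "conrad_cone G H Q" and K: "strict_cone.convex G H Q K" "K \<noteq> H"
    and R: "conrad_cone G K R"
  shows "conrad_cone G H (Q - K \<union> R)"
proof -
  interpret Q: conrad_cone G H Q by (rule Q)
  interpret R: conrad_cone G K R by (rule R)
  note K' = Q.convexD[OF K(1)]
  define U where "U b = (if b then H else K)" for b
  define L where "L b = (if b then K else R.residue)" for b
  define P where "P b = (if b then Q else R)" for b
  have "conrad_cone G H (\<Union>b\<in>UNIV. P b - L b)"
  proof (rule lex_conrad_cone)
    show "conrad_cone G (U b) (P b)" for b
      using Q R by (simp add: U_def P_def)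
    show "strict_cone.convex G (U b) (P b) (L b)" for b
      using K R.convex_residue by (simp add: U_def P_def L_def)
    show "L b \<noteq> U b" for b
      using K R.Q_nonempty R.Q_subset by (auto simp: U_def L_def R.residue_def)
    show "U b \<subseteq> H" for b
      using K' by (simp add: U_def)
    show "U b \<subseteq> L c \<or> U c \<subseteq> L b" if "b \<noteq> c" for b c
      using that by (auto simp: U_def L_def)
    show "(\<forall>b\<in>UNIV. h \<in> L b) \<or> (\<exists>b\<in>UNIV. h \<in> U b - L b)" if "h \<in> H" for h
      using that by (auto simp: U_def L_def UNIV_bool)
    show "subgroup H G" by (rule Q.subgroup_H)
  qed simp
  moreover have "(\<Union>b\<in>UNIV. P b - L b) = Q - K \<union> R"
    using R.residue_def by (auto simp: UNIV_bool P_def L_def)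
  ultimately show ?thesis by simp
qed

text \<open>Makes all elements of K equivalent to 1. This stands in for passing to the cosets of K,
  which need not form a group.\<close>

lemma coarsen_conrad_cone:
  assumes Q: "conrad_cone G H Q" and K: "strict_cone.convex G H Q K" "K \<noteq> H"
  shows "conrad_cone G H (Q - K)"
  using lex_conrad_cone[of H "{()}" "\<lambda>_. H" "\<lambda>_. Q" "\<lambda>_. K"] assms
    strict_cone.subgroup_H[OF conrad_cone.axioms(1)[OF Q]] by auto

lemma countable_conrad_cones_convex:
  assumes H: "countable (conrad_cones H)" and Q: "conrad_cone G H Q"
    and K: "strict_cone.convex G H Q K"
  shows "countable (conrad_cones K)"
proof (cases "K = H")
  case False
  define f where "f R = Q - K \<union> R" for R
  have "f ` conrad_cones K \<subseteq> conrad_cones H"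
    using replace_conrad_cone[OF Q K False] by (auto simp: conrad_cones_def f_def)
  moreover have "inj_on f (conrad_cones K)"
  proof (rule inj_on_inverseI)
    show "f R \<inter> K = R" if "R \<in> conrad_cones K" for R
      using that strict_cone.Q_subset[OF conrad_cone.axioms(1)]
      by (fastforce simp: conrad_cones_def f_def)
  qed
  ultimately show ?thesis
    using H by (meson countable_image_inj_on countable_subset)
qed (use H in simp)

text \<open>Every choice of signs on the annuli \<open>U i - L i\<close> gives a different cone.\<close>

lemma uncountable_conrad_cones_chain:
  fixes U L Q :: "nat \<Rightarrow> 'a set"
  assumes H: "subgroup H G"
    and cone: "\<And>i. conrad_cone G (U i) (Q i)"
    and conv: "\<And>i. strict_cone.convex G (U i) (Q i) (L i)"
    and proper: "\<And>i. L i \<noteq> U i"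
    and sub: "\<And>i. U i \<subseteq> H"
    and nested: "\<And>i j. i \<noteq> j \<Longrightarrow> U i \<subseteq> L j \<or> U j \<subseteq> L i"
    and cover: "\<And>h. h \<in> H \<Longrightarrow> (\<forall>i. h \<in> L i) \<or> (\<exists>i. h \<in> U i - L i)"
  shows "uncountable (conrad_cones H)"
proof
  assume count: "countable (conrad_cones H)"
  define R where "R e i = (if i \<in> e then Q i else {h \<in> U i. inv h \<in> Q i})" for e i
  define f where "f e = (\<Union>i. R e i - L i)" for e
  have f: "conrad_cone G H (f e)" for e
    unfolding f_def
  proof (rule lex_conrad_cone)
    show "conrad_cone G (U i) (R e i)" for i
      using cone conrad_cone.reverse_conrad_cone[OF cone] by (simp add: R_def)
    show "strict_cone.convex G (U i) (R e i) (L i)" for i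
      using conv conrad_cone.reverse_convex[OF cone conv] by (simp add: R_def)
  qed (use assms in auto)
  have "inj f"
  proof (rule injI, rule ccontr)
    have *: "f d \<noteq> f e" if "i \<in> d" "i \<notin> e" for d e i
    proof
      assume eq: "f d = f e"
      note scone = conrad_cone.axioms(1)[OF cone, of i]
      obtain a where a: "a \<in> Q i" "a \<notin> L i"
        using strict_cone.annulus_nonempty[OF scone conv proper] by blast
      have aU: "a \<in> U i" using a strict_cone.Q_subset[OF scone] by blast
      then have ac: "a \<in> carrier G" using sub[of i] subgroup.mem_carrier[OF H] by blast
      have "a \<in> f d" using that a by (auto simp: f_def R_def)
      moreover have "inv a \<in> R e i - L i"
        using that a ac aU strict_cone.closed(2)[OF scone aU]
          subgroup_inv_iff[OF strict_cone.convexD(1)[OF scone conv] ac] by (auto simp: R_def)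
      then have "inv a \<in> f e" by (auto simp: f_def)
      ultimately show False
        using eq strict_cone.asym[OF conrad_cone.axioms(1)[OF f]] by metis
    qed
    fix d e assume "f d = f e" "d \<noteq> e"
    then show False using * by blast
  qed
  moreover have "countable (range f)"
    by (rule countable_subset[OF _ count]) (use f in \<open>auto simp: conrad_cones_def\<close>)
  ultimately have "countable (UNIV :: nat set set)"
    using countable_image_inj_on by blast
  then obtain g :: "nat \<Rightarrow> nat set" where "range g = UNIV"
    by (metis UNIV_not_empty uncountable_def)
  then show False
    using Cantors_theorem[of "UNIV :: nat set"] by (metis Pow_UNIV)
qed

end

section \<open>Hoelder's argument modulo the residue\<close>

text \<open>By maximality of the residue the group is Archimedean and hence bi-ordered modulo the
  residue, so that Hoelder's argument applies.\<close>

locale simple_cone = conrad_cone +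
  assumes simple: "convex B \<Longrightarrow> a \<in> B \<Longrightarrow> a \<in> Q \<Longrightarrow> B = H"
begin

text \<open>The elements bounded, together with their inverses, by powers of a form a convex
  subgroup containing a, which is then all of H. The Conrad property is what makes boundedness pass
  to products.\<close>

lemma archimedean:
  assumes a: "a \<in> Q" and "h \<in> H"
  shows "\<exists>n::nat. h \<prec> a [^] n"
proof -
  have [simp]: "a \<in> H" using a by simp
  define T where "T = {h \<in> H. \<exists>n::nat. h \<prec> a [^] n}"
  define B where "B = {h \<in> H. h \<in> T \<and> inv h \<in> T}"
  have T_mult: "h \<otimes> k \<in> T" if hk: "h \<in> T" "k \<in> T" for h k
  proof -
    obtain m n :: nat where hk: "h \<in> H" "k \<in> H" "h \<prec> a [^] m" "k \<prec> a [^] n"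
      using hk by (auto simp: T_def)
    \<comment> \<open>The exponent is raised to \<open>Suc n\<close> because the Conrad property
      needs a^(n+1) to be positive, and a^0 is not. Applied to d = h^-1 a^m, it bounds h a^(n+1),
      and hence h k, by a power of a.\<close>
    have "a [^] n \<prec> a [^] Suc n"
      using less_mult[OF a, of "a [^] n"] by simp
    then have k: "k \<prec> a [^] Suc n"
      using hk less_trans[of k "a [^] n" "a [^] Suc n"] by (simp del: nat_pow_Suc)
    define d where "d = inv h \<otimes> a [^] m"
    have "d \<in> Q" using hk by (simp add: d_def less_def)
    moreover have "a [^] Suc n \<in> Q" using a by (intro pow_closed) auto
    ultimately obtain j :: nat where j: "inv (a [^] Suc n) \<otimes> (d \<otimes> (a [^] Suc n) [^] j) \<in> Q"
      using conrad by blast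
    have "(a [^] Suc n) [^] j = a [^] (Suc n * j)"
      by (rule nat_pow_pow) simp
    then have "d \<otimes> (a [^] Suc n) [^] j = inv h \<otimes> a [^] (m + Suc n * j)"
      using hk by (simp add: d_def m_assoc nat_pow_mult del: nat_pow_Suc)
    then have "h \<otimes> a [^] Suc n \<prec> a [^] (m + Suc n * j)"
      using j hk by (simp add: less_def inv_mult_group m_assoc del: nat_pow_Suc)
    moreover have "h \<otimes> k \<prec> h \<otimes> a [^] Suc n"
      using k hk by (simp add: less_mult_left del: nat_pow_Suc)
    ultimately have "h \<otimes> k \<prec> a [^] (m + Suc n * j)"
      using hk less_trans[of "h \<otimes> k" "h \<otimes> a [^] Suc n"] by (simp del: nat_pow_Suc mult_Suc)
    then show ?thesis using hk by (auto simp: T_def)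
  qed
  have T_le: "h \<in> T" if "h \<in> H" "h \<notin> Q" for h
  proof -
    have "inv h \<otimes> a \<in> Q" using a that by (intro mult_left) auto
    then have "h \<prec> a [^] (1::nat)" by (simp add: less_def)
    then show ?thesis using that unfolding T_def by blast
  qed
  have "convex B"
    unfolding convex_def
  proof (intro conjI ballI)
    show "subgroup B G"
    proof (rule subgroupI)
      have "\<one> \<in> B" using T_le[of \<one>] by (simp add: B_def)
      then show "B \<noteq> {}" by blast
    qed (auto simp: B_def inv_mult_group T_mult)
    show "B \<subseteq> H" by (auto simp: B_def)
    show "h \<in> Q \<or> inv h \<in> Q" if "h \<in> H - B" for h
      using that T_le[of h] T_le[of "inv h"] by (auto simp: B_def)
    show "k \<otimes> h \<in> Q" if h: "h \<in> Q - B" and k: "k \<in> B" for h k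
    proof (rule ccontr)
      assume kh: "k \<otimes> h \<notin> Q"
      have "k \<in> H" "inv k \<in> T" using k by (auto simp: B_def)
      moreover have "k \<otimes> h \<in> T" using kh h \<open>k \<in> H\<close> by (intro T_le) auto
      ultimately have "h \<in> T" using T_mult[of "inv k" "k \<otimes> h"] h by simp
      moreover have "inv h \<in> T" using h asym by (intro T_le) auto
      ultimately show False using h by (auto simp: B_def)
    qed
  qed
  moreover have "a \<in> B"
  proof -
    have "a \<prec> a [^] (2::nat)" using a by (simp add: less_def numeral_2_eq_2 m_assoc)
    then have "a \<in> T" unfolding T_def by (auto simp del: nat_pow_Suc)
    moreover have "inv a \<in> T" using a asym by (intro T_le) auto
    ultimately show ?thesis by (simp add: B_def)
  qed
  ultimately have "B = H" using simple a by blast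
  then show ?thesis using \<open>h \<in> H\<close> by (auto simp: B_def T_def)
qed

lemma reverse_simple_cone: "simple_cone G H {h \<in> H. inv h \<in> Q}"
proof -
  interpret R: conrad_cone G H "{h \<in> H. inv h \<in> Q}" by (rule reverse_conrad_cone)
  note R.QI [simp del]
  have QQ: "{h \<in> H. inv h \<in> {h \<in> H. inv h \<in> Q}} = Q" by auto
  have "B = H" if B: "R.convex B" "a \<in> B" "a \<in> {h \<in> H. inv h \<in> Q}" for B a
  proof -
    have "convex B" using R.reverse_convex[OF B(1)] by (simp only: QQ)
    moreover have "inv a \<in> B" using R.convexD(1)[OF B(1)] B(2) by (rule subgroup.m_inv_closed)
    ultimately show ?thesis using simple B(3) by blast
  qed
  then show ?thesis
    by (simp add: simple_cone_def simple_cone_axioms_def reverse_conrad_cone)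
qed

text \<open>Bounding h^-1 by \<open>archimedean\<close> would only give a positive h a^n. The power
  gets to the left of h by applying the bound in the reversed order instead.\<close>

lemma archimedean':
  assumes a: "a \<in> Q" and h: "h \<in> H"
  shows "\<exists>n::nat. a [^] n \<otimes> h \<in> Q"
proof -
  interpret R: simple_cone G H "{h \<in> H. inv h \<in> Q}" by (rule reverse_simple_cone)
  note R.QI [simp del]
  obtain n :: nat where "R.less h (inv a [^] n)"
    using R.archimedean[of "inv a" h] a h by auto
  then show ?thesis
    using a h by (auto simp: R.less_def inv_mult_group simp flip: nat_pow_inv)
qed

text \<open>This is right-invariance of the order. If a g \<preceq> g, then a^n g \<preceq> g for
  all n. As some a^n g is positive, so is g; but then g \<prec> a^m \<prec> a^m g for a suitable m,
  a contradiction.\<close>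

lemma conj_closed:
  assumes a: "a \<in> Q" and g: "g \<in> H"
  shows "inv g \<otimes> (a \<otimes> g) \<in> Q"
proof (rule ccontr)
  assume "\<not> ?thesis"
  then have le: "\<not> g \<prec> a [^] n \<otimes> g" for n :: nat
    using a g by (intro pow_le) (auto simp: less_def)
  obtain n :: nat where "a [^] n \<otimes> g \<in> Q" using archimedean'[OF a g] by blast
  then have "\<one> \<prec> a [^] n \<otimes> g" using a g by (simp add: less_def)
  then have "\<one> \<prec> g" using le[of n] a g by (intro less_le_trans[of \<one> "a [^] n \<otimes> g" g]) auto
  then have gQ: "g \<in> Q" using g by (simp add: less_def)
  obtain m :: nat where m: "g \<prec> a [^] m" using archimedean[OF a g] by blast
  have "a [^] m \<prec> a [^] m \<otimes> g" using a gQ by (intro less_mult) auto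
  then have "g \<prec> a [^] m \<otimes> g" using m a g less_trans[of g "a [^] m"] by simp
  then show False using le by blast
qed

lemma conj_iff: "inv g \<otimes> (a \<otimes> g) \<in> Q \<longleftrightarrow> a \<in> Q" if "a \<in> H" "g \<in> H"
  using conj_closed[of a g] conj_closed[of "inv g \<otimes> (a \<otimes> g)" "inv g"] that
  by (auto simp: m_assoc)

lemma less_mult_right: "x \<otimes> g \<prec> y \<otimes> g \<longleftrightarrow> x \<prec> y" if "x \<in> H" "y \<in> H" "g \<in> H"
  using conj_iff[of "inv x \<otimes> y" g] that by (simp add: less_def inv_mult_group m_assoc)

lemma euclidean_division:
  assumes u: "u \<in> Q" and x: "x \<in> H"
  obtains m :: int and r where "r \<in> H" "x = u [^] m \<otimes> r" "\<not> r \<prec> \<one>" "r \<prec> u"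
proof -
  have [simp]: "u \<in> H" "x \<in> H" using u x by auto
  \<comment> \<open>Shifting x by u^M makes it positive, so the quotient comes from a least natural
    number n, which is not 0. The integer quotient is then n - 1 - M.\<close>
  obtain M :: nat where M: "u [^] M \<otimes> x \<in> Q" using archimedean'[OF u x] by blast
  define y where "y = u [^] M \<otimes> x"
  have [simp]: "y \<in> H" by (simp add: y_def)
  define n where "n = (LEAST n::nat. y \<prec> u [^] n)"
  have n: "y \<prec> u [^] n"
    unfolding n_def using archimedean[OF u, of y] by (auto intro: LeastI_ex)
  have "n \<noteq> 0"
  proof
    assume "n = 0"
    then have "inv y \<in> Q" using n by (simp add: less_def)
    then show False using asym[OF M] by (simp add: y_def)
  qed
  then obtain k where k: "n = Suc k" by (cases n) auto
  then have not: "\<not> y \<prec> u [^] k"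
    unfolding n_def using not_less_Least[of k] by (metis lessI n_def)
  define r where "r = inv (u [^] k) \<otimes> y"
  have [simp]: "r \<in> H" by (simp add: r_def)
  have "x = inv (u [^] M) \<otimes> (u [^] k \<otimes> r)"
    by (simp add: r_def y_def)
  also have "\<dots> = u [^] (int k - int M) \<otimes> r"
  proof -
    have "u [^] (int k - int M) = u [^] (- int M + int k)" by simp
    also have "\<dots> = u [^] (- int M) \<otimes> u [^] (int k)" by (rule int_pow_mult) simp
    also have "\<dots> = inv (u [^] M) \<otimes> u [^] k"
      by (simp add: int_pow_neg_int int_pow_int)
    finally show ?thesis by (simp add: m_assoc)
  qed
  finally have "x = u [^] (int k - int M) \<otimes> r" .
  moreover have "\<not> r \<prec> \<one>"
    using not by (simp add: r_def less_def inv_mult_group)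
  moreover have "r \<prec> u"
    using n by (simp add: r_def less_def k inv_mult_group m_assoc)
  ultimately show ?thesis using that[of r "int k - int M"] by simp
qed

text \<open>Write x = u^m r and y = u^n s with remainders in [1, u). Moving the powers of u to the
  front replaces r and s by the conjugates r' = u^-n r u^n and s' = u^-m s u^m, which stay in [1, u)
  by bi-invariance. The powers then cancel in the commutator.\<close>

lemma commutator_reduce:
  assumes u: "u \<in> Q" and xy: "x \<in> H" "y \<in> H"
  obtains r r' s s' where "r \<in> H" "r' \<in> H" "s \<in> H" "s' \<in> H"
    "\<not> r \<prec> \<one>" "\<not> s' \<prec> \<one>" "r' \<prec> u" "s \<prec> u"
    "inv (y \<otimes> x) \<otimes> (x \<otimes> y) = inv (s' \<otimes> r) \<otimes> (r' \<otimes> s)"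
proof -
  obtain m :: int and r where r: "r \<in> H" "x = u [^] m \<otimes> r" "\<not> r \<prec> \<one>" "r \<prec> u"
    using euclidean_division[OF u xy(1)] by blast
  obtain n :: int and s where s: "s \<in> H" "y = u [^] n \<otimes> s" "\<not> s \<prec> \<one>" "s \<prec> u"
    using euclidean_division[OF u xy(2)] by blast
  have [simp]: "u \<in> H" using u by simp
  define c where "c t i = inv (u [^] i) \<otimes> (t \<otimes> u [^] i)" for t and i :: int
  have c: "c t i \<in> H" "\<not> c t i \<prec> \<one>" "c t i \<prec> u" if t: "t \<in> H" "\<not> t \<prec> \<one>" "t \<prec> u" for t i
  proof -
    show ct: "c t i \<in> H" using t by (simp add: c_def)
    have inv_c: "inv (c t i) = inv (u [^] i) \<otimes> (inv t \<otimes> u [^] i)"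
      using t by (simp add: c_def inv_mult_group m_assoc)
    show "\<not> c t i \<prec> \<one>"
      using t ct conj_iff[of "inv t" "u [^] i"] by (simp add: less_def inv_c)
    have comm: "u \<otimes> u [^] i = u [^] i \<otimes> u"
      using int_pow_mult[of u 1 i] int_pow_mult[of u i 1] by (simp add: add.commute[of 1 i])
    have "inv (c t i) \<otimes> u = inv (u [^] i) \<otimes> (inv t \<otimes> u \<otimes> u [^] i)"
      using t by (simp add: inv_c m_assoc comm)
    then show "c t i \<prec> u"
      using t conj_iff[of "inv t \<otimes> u" "u [^] i"] by (simp add: less_def)
  qed
  have comm: "u [^] m \<otimes> u [^] n = u [^] n \<otimes> u [^] m"
    using int_pow_mult[of u m n] int_pow_mult[of u n m] by (simp add: add.commute[of m n])
  have "x \<otimes> y = u [^] m \<otimes> u [^] n \<otimes> (c r n \<otimes> s)"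
    using r s by (simp add: c_def m_assoc)
  moreover have "y \<otimes> x = u [^] m \<otimes> u [^] n \<otimes> (c s m \<otimes> r)"
    using r s by (simp add: c_def m_assoc comm) 
  ultimately have eq: "inv (y \<otimes> x) \<otimes> (x \<otimes> y) = inv (c s m \<otimes> r) \<otimes> (c r n \<otimes> s)"
    using r s c(1)[OF r(1,3,4)] c(1)[OF s(1,3,4)] by (simp add: inv_mult_group m_assoc)
  note cr = c[OF r(1,3,4), of n] and cs = c[OF s(1,3,4), of m]
  show ?thesis
    by (rule that[OF r(1) cr(1) s(1) cs(1) r(3) cs(2) cr(3) s(4) eq])
qed

text \<open>Treats discrete and dense orders together: a positive commutator z lies below every
  square of a positive element, which forces it to be a least positive element; reducing with u = z
  then shows that it is not positive.\<close>

lemma commutator_not_positive: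
  assumes xy: "x \<in> H" "y \<in> H"
  shows "inv (y \<otimes> x) \<otimes> (x \<otimes> y) \<notin> Q"
proof
  define z where "z = inv (y \<otimes> x) \<otimes> (x \<otimes> y)"
  assume "inv (y \<otimes> x) \<otimes> (x \<otimes> y) \<in> Q"
  then have z: "z \<in> Q" by (simp add: z_def)
  have small: "z \<prec> u \<otimes> u" if u: "u \<in> Q" for u
  proof -
    have [simp]: "u \<in> H" using u by simp
    obtain r r' s s' where H: "r \<in> H" "r' \<in> H" "s \<in> H" "s' \<in> H"
      and pos: "\<not> r \<prec> \<one>" "\<not> s' \<prec> \<one>" and ub: "r' \<prec> u" "s \<prec> u"
      and zeq: "z = inv (s' \<otimes> r) \<otimes> (r' \<otimes> s)"
      by (rule commutator_reduce[OF u xy, folded z_def])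
    define w where "w = s' \<otimes> r"
    have w [simp]: "w \<in> H" using H by (simp add: w_def)
    have "inv r \<otimes> inv s' \<notin> Q"
      using pos H by (intro compl_closed) (auto simp: less_def)
    then have "\<not> w \<prec> \<one>" using H by (simp add: w_def less_def inv_mult_group)
    then have "\<not> w \<otimes> (u \<otimes> u) \<prec> u \<otimes> u"
      using less_mult_right[of w \<one> "u \<otimes> u"] by simp
    moreover have "r' \<otimes> s \<prec> u \<otimes> u"
      using ub H less_mult_left[of r' s u] less_mult_right[of r' u u]
      by (intro less_trans[of "r' \<otimes> s" "r' \<otimes> u" "u \<otimes> u"]) auto
    ultimately have "r' \<otimes> s \<prec> w \<otimes> (u \<otimes> u)"
      using H less_le_trans[of "r' \<otimes> s" "u \<otimes> u" "w \<otimes> (u \<otimes> u)"] by simp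
    then show ?thesis
      using H by (simp add: less_def zeq w_def[symmetric] inv_mult_group m_assoc)
  qed
  \<comment> \<open>If v \<prec> z, split z = v w. The square of the smaller of v and w is then at
    most z, contradicting \<open>small\<close>.\<close>
  have min: "\<not> v \<prec> z" if v: "v \<in> Q" for v
  proof
    assume "v \<prec> z"
    define w where "w = inv v \<otimes> z"
    have w: "w \<in> Q" using \<open>v \<prec> z\<close> by (simp add: w_def less_def)
    have zvw: "z = v \<otimes> w" using v z by (simp add: w_def)
    show False
    proof (cases "w \<prec> v")
      case True
      then have "w \<otimes> w \<prec> z" using v w by (simp add: zvw less_mult_right)
      then show False
        using small[OF w] less_trans[of z "w \<otimes> w" z] less_irrefl[of z] z w by simp
    next
      case False
      then have "\<not> z \<prec> v \<otimes> v" using v w by (simp add: zvw less_mult_left)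
      then show False using small[OF v] by blast
    qed
  qed
  obtain r r' s s' where H: "r \<in> H" "r' \<in> H" "s \<in> H" "s' \<in> H"
    and pos: "\<not> r \<prec> \<one>" "\<not> s' \<prec> \<one>" and ub: "r' \<prec> z" "s \<prec> z"
    and zeq: "z = inv (s' \<otimes> r) \<otimes> (r' \<otimes> s)"
    by (rule commutator_reduce[OF z xy, folded z_def])
  \<comment> \<open>Below a least positive element there is nothing positive, so r' and s are at
    most 1, as are the inverses of r and s'.\<close>
  have "r' \<otimes> s \<notin> Q"
    using min ub H by (intro compl_closed) auto
  moreover have "inv r \<otimes> inv s' \<notin> Q"
    using pos H by (intro compl_closed) (auto simp: less_def)
  ultimately have "inv r \<otimes> inv s' \<otimes> (r' \<otimes> s) \<notin> Q"
    using H compl_closed[of "inv r \<otimes> inv s'" "r' \<otimes> s"] by simp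
  then show False
    using z H by (simp add: zeq inv_mult_group)
qed

lemma commutator_in_residue:
  assumes "x \<in> H" "y \<in> H"
  shows "inv (y \<otimes> x) \<otimes> (x \<otimes> y) \<in> residue"
  using assms commutator_not_positive[of x y] commutator_not_positive[of y x]
  by (simp add: residue_def inv_diff)

end

text \<open>Collapsing K gives the cone Q - K with residue K. Its convex subgroups contain K and are
  convex for Q, so maximality of K makes it a \<open>simple_cone\<close>.\<close>

lemma (in conrad_cone) commutator_in_maximal_convex:
  assumes K: "convex K" "K \<noteq> H"
    and max: "\<And>B. convex B \<Longrightarrow> K \<subset> B \<Longrightarrow> B = H"
    and xy: "x \<in> H" "y \<in> H"
  shows "inv (y \<otimes> x) \<otimes> (x \<otimes> y) \<in> K"
proof -
  have S: "conrad_cone G H (Q - K)"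
    by (rule coarsen_conrad_cone[OF _ K]) unfold_locales
  interpret S: conrad_cone G H "Q - K" by (rule S)
  note K' = convexD[OF K(1)]
  have res: "S.residue = K"
  proof (intro equalityI subsetI)
    show "h \<in> K" if "h \<in> S.residue" for h
      using that K'(3)[of h] subgroup_inv_iff[OF K'(1), of h] by (auto simp: S.residue_def)
    show "h \<in> S.residue" if "h \<in> K" for h
      using that K'(2) subgroup.m_inv_closed[OF K'(1) that] by (auto simp: S.residue_def)
  qed
  have "B = H" if B: "S.convex B" "a \<in> B" "a \<in> Q - K" for B a
  proof (rule max)
    note B' = S.convexD[OF B(1)]
    have KB: "K \<subseteq> B"
    proof
      fix k assume "k \<in> K"
      then have "k \<in> H" "k \<notin> Q - K" "inv k \<notin> Q - K"
        using res S.residue_def by auto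
      then show "k \<in> B" using B'(3) by blast
    qed
    then show "K \<subset> B" using B by blast
    show "convex B"
      unfolding convex_def using B' KB by blast
  qed
  then interpret S: simple_cone G H "Q - K"
    by unfold_locales
  show ?thesis using S.commutator_in_residue[OF xy] by (simp add: res)
qed

section \<open>Cones from abelian quotients of rank two\<close>

text \<open>Zorn's lemma: a maximal subsemigroup avoiding \<open>\<one>\<close> is the strictly positive part of a
  preorder.\<close>

lemma (in comm_group) extend_to_strict_cone:
  assumes S: "S \<subseteq> carrier G" "\<one> \<notin> S" "\<And>a b. a \<in> S \<Longrightarrow> b \<in> S \<Longrightarrow> a \<otimes> b \<in> S"
  obtains M where "S \<subseteq> M" "M \<subseteq> carrier G" "\<And>a. a \<in> M \<Longrightarrow> inv a \<notin> M"
    "\<And>a b. a \<in> carrier G \<Longrightarrow> a \<notin> M \<Longrightarrow> b \<in> carrier G \<Longrightarrow> b \<notin> M \<Longrightarrow> a \<otimes> b \<notin> M"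
proof -
  define F where "F = {M. S \<subseteq> M \<and> M \<subseteq> carrier G \<and> \<one> \<notin> M \<and> (\<forall>a\<in>M. \<forall>b\<in>M. a \<otimes> b \<in> M)}"
  have "\<exists>M\<in>F. \<forall>X\<in>F. M \<subseteq> X \<longrightarrow> X = M"
  proof (rule subset_Zorn_nonempty)
    show "F \<noteq> {}" using S by (auto simp: F_def)
    fix C assume C: "C \<noteq> {}" "subset.chain F C"
    then have CF: "C \<subseteq> F" by (simp add: subset.chain_def)
    have "a \<otimes> b \<in> \<Union> C" if ab: "a \<in> \<Union> C" "b \<in> \<Union> C" for a b
    proof -
      obtain X Y where XY: "X \<in> C" "a \<in> X" "Y \<in> C" "b \<in> Y" using ab by blast
      then have "X \<subseteq> Y \<or> Y \<subseteq> X" using C(2) by (auto simp: subset_chain_def)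
      then obtain Z where "Z \<in> C" "a \<in> Z" "b \<in> Z" using XY by blast
      then show ?thesis using CF by (auto simp: F_def)
    qed
    then show "\<Union> C \<in> F"
      using C(1) CF by (fastforce simp: F_def)
  qed
  then obtain M where M: "M \<in> F" and max: "\<And>X. X \<in> F \<Longrightarrow> M \<subseteq> X \<Longrightarrow> X = M" by blast
  have SM: "S \<subseteq> M" and MG: "M \<subseteq> carrier G" and one: "\<one> \<notin> M"
    and mult: "\<And>a b. a \<in> M \<Longrightarrow> b \<in> M \<Longrightarrow> a \<otimes> b \<in> M"
    using M by (auto simp: F_def)
  have [simp]: "a \<in> carrier G" if "a \<in> M" for a using MG that by blast
  have M_pow: "a [^] n \<in> M" if "a \<in> M" "n > 0" for a and n :: nat
    using that(2)
  proof (induction n)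
    case (Suc n)
    then show ?case using that(1) by (cases "n = 0") (auto intro: mult)
  qed simp
  have outside: "\<exists>n>0. inv (a [^] (n::nat)) \<in> insert \<one> M" if a: "a \<in> carrier G" "a \<notin> M" for a
  proof (rule ccontr)
    assume none: "\<not> ?thesis"
    \<comment> \<open>The semigroup generated by M and a; the side condition removes the empty
      product. If no a^-n with n > 0 were in M or equal to 1, X would avoid the identity, so
      maximality would put a into M.\<close>
    define X where "X = {m \<otimes> a [^] n |m n. m \<in> insert \<one> M \<and> (m \<in> M \<or> n > (0::nat))}"
    have "X \<in> F"
      unfolding F_def
    proof (intro CollectI conjI ballI)
      have "m \<in> X" if "m \<in> M" for m
        unfolding X_def using that by (intro CollectI exI[of _ m] exI[of _ 0]) auto
      then show "S \<subseteq> X" using SM by blast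
      show "X \<subseteq> carrier G" using a by (auto simp: X_def)
      show "\<one> \<notin> X"
      proof
        assume "\<one> \<in> X"
        then obtain m n where mn: "\<one> = m \<otimes> a [^] (n::nat)" "m \<in> insert \<one> M" "m \<in> M \<or> n > 0"
          by (auto simp: X_def)
        then have mc: "m \<in> carrier G" by auto
        then have "m = inv (a [^] n)"
          using mn(1) a inv_equality[of m "a [^] n"] by simp
        moreover have "n \<noteq> 0" using mn mc one by (cases "n = 0") auto
        ultimately show False using none mn(2) by blast
      qed
      fix x y assume "x \<in> X" "y \<in> X"
      then obtain m n k l where x: "x = m \<otimes> a [^] (n::nat)" "m \<in> insert \<one> M" "m \<in> M \<or> n > 0"
        and y: "y = k \<otimes> a [^] (l::nat)" "k \<in> insert \<one> M" "k \<in> M \<or> l > 0"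
        by (auto simp: X_def)
      have mk: "m \<in> carrier G" "k \<in> carrier G" using x y by auto
      have "x \<otimes> y = (m \<otimes> k) \<otimes> a [^] (n + l)"
        using mk a nat_pow_mult[of a n l] by (simp add: x y m_ac)
      moreover have "m \<otimes> k \<in> insert \<one> M" "m \<otimes> k \<in> M \<or> n + l > 0"
        using x y mk mult by auto
      ultimately show "x \<otimes> y \<in> X" unfolding X_def by blast
    qed
    moreover have "M \<subseteq> X"
    proof
      show "m \<in> X" if "m \<in> M" for m
        unfolding X_def using that by (intro CollectI exI[of _ m] exI[of _ 0]) auto
    qed
    ultimately have "X = M" using max by blast
    moreover have "a \<in> X"
      unfolding X_def using a by (intro CollectI exI[of _ \<one>] exI[of _ 1]) auto
    ultimately show False using a by blast
  qed
  have asym: "inv a \<notin> M" if "a \<in> M" for a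
    using mult[OF that, of "inv a"] one that by auto
  moreover have "a \<otimes> b \<notin> M" if ab: "a \<in> carrier G" "a \<notin> M" "b \<in> carrier G" "b \<notin> M" for a b
  proof
    assume abM: "a \<otimes> b \<in> M"
    \<comment> \<open>In the common exponent n k, commutativity makes (a b)^(-n k) a product of
      powers of a^-n and b^-k, hence in M or 1, although (a b)^(n k) is in M.\<close>
    obtain n k :: nat where nk: "n > 0" "k > 0" "inv (a [^] n) \<in> insert \<one> M" "inv (b [^] k) \<in> insert \<one> M"
      using outside ab by metis
    have pow: "x [^] i \<in> insert \<one> M" if "x \<in> insert \<one> M" for x and i :: nat
      using that M_pow[of x i] by (cases "i = 0") auto
    have m1: "x \<otimes> y \<in> insert \<one> M" if "x \<in> insert \<one> M" "y \<in> insert \<one> M" for x y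
      using that mult by auto
    have "inv ((a \<otimes> b) [^] (n * k)) = inv (a [^] n) [^] k \<otimes> inv (b [^] k) [^] n"
      using ab by (simp add: nat_pow_distrib nat_pow_pow inv_mult_group m_comm nat_pow_inv mult.commute)
    also have "\<dots> \<in> insert \<one> M"
      using nk by (intro m1 pow)
    finally have inv: "inv ((a \<otimes> b) [^] (n * k)) \<in> insert \<one> M" .
    have "(a \<otimes> b) [^] (n * k) \<in> M" using nk abM by (intro M_pow) auto
    then show False using inv asym one ab
      by (metis (no_types, lifting) inv_inv inv_one insert_iff m_closed nat_pow_closed)
  qed
  ultimately show ?thesis using that SM MG by blast
qed

context group
begin

text \<open>The Conrad property holds with n = 1, because a^-1 b a and b have the same image in the
  abelian group A.\<close>

lemma conrad_cone_pullback:
  assumes A: "comm_group A" and H: "subgroup H G" and \<phi>: "\<phi> \<in> hom (G\<lparr>carrier := H\<rparr>) A"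
    and M: "M \<subseteq> carrier A" "\<And>a. a \<in> M \<Longrightarrow> inv\<^bsub>A\<^esub> a \<notin> M"
      "\<And>a b. a \<in> carrier A \<Longrightarrow> a \<notin> M \<Longrightarrow> b \<in> carrier A \<Longrightarrow> b \<notin> M \<Longrightarrow> a \<otimes>\<^bsub>A\<^esub> b \<notin> M"
    and h: "h \<in> H" "\<phi> h \<in> M"
  shows "conrad_cone G H {h \<in> H. \<phi> h \<in> M}"
proof -
  interpret A: comm_group A by (rule A)
  interpret \<phi>: group_hom "G\<lparr>carrier := H\<rparr>" A \<phi>
    using subgroup.subgroup_is_group[OF H is_group] A.is_group \<phi>
    by (simp add: group_hom_def group_hom_axioms_def)
  have \<phi>_closed: "\<phi> x \<in> carrier A" if "x \<in> H" for x
    using \<phi>.hom_closed that by simp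
  have \<phi>_mult: "\<phi> (x \<otimes> y) = \<phi> x \<otimes>\<^bsub>A\<^esub> \<phi> y" if "x \<in> H" "y \<in> H" for x y
    using \<phi>.hom_mult[of x y] that by simp
  have \<phi>_inv: "\<phi> (inv x) = inv\<^bsub>A\<^esub> (\<phi> x)" if "x \<in> H" for x
    using \<phi>.hom_inv[of x] m_inv_consistent[OF H that] that by simp
  note [intro] = subgroup.m_closed[OF H] subgroup.m_inv_closed[OF H]
  show ?thesis
  proof (rule conrad_coneI)
    show "\<exists>n::nat. inv a \<otimes> (b \<otimes> a [^] n) \<in> {h \<in> H. \<phi> h \<in> M}"
      if "a \<in> {h \<in> H. \<phi> h \<in> M}" "b \<in> {h \<in> H. \<phi> h \<in> M}" for a b
    proof (intro exI[of _ 1])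
      have ab: "a \<in> H" "b \<in> H" "\<phi> b \<in> M" using that by auto
      then have "inv a \<otimes> (b \<otimes> a) \<in> H" by blast
      moreover have "\<phi> (inv a \<otimes> (b \<otimes> a)) = \<phi> b"
        using ab \<phi>_closed[of a] \<phi>_closed[of b]
        by (simp add: \<phi>_mult \<phi>_inv subgroup.m_closed[OF H] subgroup.m_inv_closed[OF H] A.m_lcomm[of "inv\<^bsub>A\<^esub> \<phi> a"])
      ultimately show "inv a \<otimes> (b \<otimes> a [^] (1::nat)) \<in> {h \<in> H. \<phi> h \<in> M}"
        using ab subgroup.mem_carrier[OF H] by auto
    qed
  next
    show "a \<otimes> b \<notin> {h \<in> H. \<phi> h \<in> M}"
      if "a \<in> H" "a \<notin> {h \<in> H. \<phi> h \<in> M}" "b \<in> H" "b \<notin> {h \<in> H. \<phi> h \<in> M}" for a b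
      using that M(3)[of "\<phi> a" "\<phi> b"] \<phi>_closed \<phi>_mult by auto
  next
    show "inv a \<notin> {h \<in> H. \<phi> h \<in> M}" if "a \<in> {h \<in> H. \<phi> h \<in> M}" for a
      using that M(2)[of "\<phi> a"] \<phi>_inv by auto
  next
    show "{h \<in> H. \<phi> h \<in> M} \<noteq> {}" using h by blast
  qed (use H in auto)
qed

lemma normal_of_commutators:
  assumes H: "subgroup H G" and K: "subgroup K G" "K \<subseteq> H"
    and comm: "\<And>x y. x \<in> H \<Longrightarrow> y \<in> H \<Longrightarrow> inv (y \<otimes> x) \<otimes> (x \<otimes> y) \<in> K"
  shows "K \<lhd> G\<lparr>carrier := H\<rparr>"
proof -
  have grp: "group (G\<lparr>carrier := H\<rparr>)" using subgroup.subgroup_is_group[OF H is_group] .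
  have sub: "subgroup K (G\<lparr>carrier := H\<rparr>)"
    using subgroup_incl[OF K(1) H K(2)] .
  have "x \<otimes> k \<otimes> inv x \<in> K" if x: "x \<in> H" and k: "k \<in> K" for x k
  proof -
    have kH: "k \<in> H" using k K(2) by blast
    have c: "x \<in> carrier G" "k \<in> carrier G" using x kH subgroup.mem_carrier[OF H] by auto
    have "inv (inv k \<otimes> inv x) \<otimes> (inv x \<otimes> inv k) \<in> K"
      using x kH by (intro comm subgroup.m_inv_closed[OF H])
    then have "x \<otimes> k \<otimes> inv x \<otimes> inv k \<in> K"
      using c by (simp add: inv_mult_group m_assoc)
    then show ?thesis
      using subgroup_mult_right_iff[OF K(1) subgroup.m_inv_closed[OF K(1) k]] c by simp
  qed
  then show ?thesis
    using group.normal_inv_iff[OF grp] sub m_inv_consistent[OF H] by simp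
qed

text \<open>H modulo K is abelian, and x and y generate a copy of Z^2 in it. Each half-plane of real
  slope in Z^2 is a semigroup avoiding the identity, so it extends to a cone on the quotient and
  pulls back to H.\<close>

lemma uncountable_conrad_cones_rank_two:
  assumes H: "subgroup H G" and K: "subgroup K G" "K \<subseteq> H"
    and comm: "\<And>x y. x \<in> H \<Longrightarrow> y \<in> H \<Longrightarrow> inv (y \<otimes> x) \<otimes> (x \<otimes> y) \<in> K"
    and xy: "x \<in> H" "y \<in> H"
    and indep: "\<And>(a::int) (b::int). x [^] a \<otimes> y [^] b \<in> K \<Longrightarrow> a = 0 \<and> b = 0"
  shows "uncountable (conrad_cones H)"
proof
  assume count: "countable (conrad_cones H)"
  interpret N: normal K "G\<lparr>carrier := H\<rparr>"
    using normal_of_commutators[OF H K comm] .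
  define A where "A = G\<lparr>carrier := H\<rparr> Mod K"
  define \<phi> where "\<phi> h = K #>\<^bsub>G\<lparr>carrier := H\<rparr>\<^esub> h" for h
  have hom: "\<phi> \<in> hom (G\<lparr>carrier := H\<rparr>) A"
    using N.r_coset_hom_Mod by (simp add: A_def \<phi>_def[abs_def])
  have grpA: "group A" unfolding A_def by (rule N.factorgroup_is_group)
  interpret A: group A by (rule grpA)
  interpret \<phi>: group_hom "G\<lparr>carrier := H\<rparr>" A \<phi>
    using N.is_group grpA hom by (simp add: group_hom_def group_hom_axioms_def)
  have Hc: "h \<in> carrier G" if "h \<in> H" for h
    using that by (rule subgroup.mem_carrier[OF H])
  have \<phi>_closed: "\<phi> h \<in> carrier A" if "h \<in> H" for h
    using \<phi>.hom_closed that by simp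
  have \<phi>_mult: "\<phi> (g \<otimes> h) = \<phi> g \<otimes>\<^bsub>A\<^esub> \<phi> h" if "g \<in> H" "h \<in> H" for g h
    using \<phi>.hom_mult[of g h] that by simp
  have \<phi>_inv: "\<phi> (inv h) = inv\<^bsub>A\<^esub> (\<phi> h)" if "h \<in> H" for h
    using \<phi>.hom_inv[of h] m_inv_consistent[OF H that] that by simp
  have \<phi>_one: "\<phi> h = \<one>\<^bsub>A\<^esub> \<longleftrightarrow> h \<in> K" if "h \<in> H" for h
  proof
    assume "\<phi> h = \<one>\<^bsub>A\<^esub>"
    then have "K #>\<^bsub>G\<lparr>carrier := H\<rparr>\<^esub> h = K" by (simp add: A_def \<phi>_def FactGroup_def)
    then show "h \<in> K" using N.rcos_self[OF _ N.subgroup_axioms, of h] that by auto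
  next
    assume "h \<in> K"
    then show "\<phi> h = \<one>\<^bsub>A\<^esub>"
      using N.rcos_const[OF N.is_group, of h] by (simp add: A_def \<phi>_def FactGroup_def)
  qed
  have commA: "comm_group A"
  proof (rule A.group_comm_groupI)
    fix X Y assume "X \<in> carrier A" "Y \<in> carrier A"
    then obtain g h where gh: "g \<in> H" "h \<in> H" "X = \<phi> g" "Y = \<phi> h"
      by (auto simp: A_def \<phi>_def FactGroup_def RCOSETS_def)
    have "\<phi> (inv (h \<otimes> g) \<otimes> (g \<otimes> h)) = \<one>\<^bsub>A\<^esub>"
      using comm[OF gh(1,2)] K(2) by (subst \<phi>_one) auto
    moreover have "\<phi> (inv (h \<otimes> g) \<otimes> (g \<otimes> h)) = inv\<^bsub>A\<^esub> (Y \<otimes>\<^bsub>A\<^esub> X) \<otimes>\<^bsub>A\<^esub> (X \<otimes>\<^bsub>A\<^esub> Y)"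
      using gh by (simp add: \<phi>_mult \<phi>_inv subgroup.m_closed[OF H] subgroup.m_inv_closed[OF H])
    ultimately show "X \<otimes>\<^bsub>A\<^esub> Y = Y \<otimes>\<^bsub>A\<^esub> X"
      using gh \<phi>_closed A.inv_solve_left[of "\<one>\<^bsub>A\<^esub>" "Y \<otimes>\<^bsub>A\<^esub> X" "X \<otimes>\<^bsub>A\<^esub> Y"] by auto
  qed
  interpret A: comm_group A by (rule commA)
  define v where "v a b = x [^] a \<otimes> y [^] b" for a b :: int
  define X where "X = \<phi> x"
  define Y where "Y = \<phi> y"
  have XY: "X \<in> carrier A" "Y \<in> carrier A" using xy \<phi>_closed by (auto simp: X_def Y_def)
  have pow_H: "h [^] (a::int) \<in> H" if "h \<in> H" for h a
    using subgroup_int_pow_closed[OF H that] .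
  have vH: "v a b \<in> H" for a b
    using pow_H xy subgroup.m_closed[OF H] by (simp add: v_def)
  have \<phi>_pow: "\<phi> (h [^] a) = \<phi> h [^]\<^bsub>A\<^esub> a" if "h \<in> H" for h and a :: int
    using \<phi>.hom_int_pow[of h a] int_pow_consistent[OF H that] that by simp
  have \<phi>_v: "\<phi> (v a b) = X [^]\<^bsub>A\<^esub> a \<otimes>\<^bsub>A\<^esub> Y [^]\<^bsub>A\<^esub> b" for a b
    using xy pow_H by (simp add: v_def \<phi>_mult \<phi>_pow X_def Y_def)
  have v_add: "\<phi> (v a b) \<otimes>\<^bsub>A\<^esub> \<phi> (v c d) = \<phi> (v (a + c) (b + d))" for a b c d
    using XY by (simp add: \<phi>_v A.int_pow_mult A.m_ac)
  define S where "S r = {\<phi> (v a b) |a b. real_of_int a + r * real_of_int b > 0}" for r :: real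
  have "\<exists>M. S r \<subseteq> M \<and> conrad_cone G H {h \<in> H. \<phi> h \<in> M}" for r
  proof -
    have Ssub: "S r \<subseteq> carrier A" using vH \<phi>_closed by (auto simp: S_def)
    have Sone: "\<one>\<^bsub>A\<^esub> \<notin> S r"
    proof
      assume "\<one>\<^bsub>A\<^esub> \<in> S r"
      then obtain a b where ab: "\<phi> (v a b) = \<one>\<^bsub>A\<^esub>" "real_of_int a + r * real_of_int b > 0"
        by (auto simp: S_def)
      then have "v a b \<in> K" using \<phi>_one[OF vH] by blast
      then show False using indep[of a b] ab(2) by (simp add: v_def)
    qed
    have Smult: "s \<otimes>\<^bsub>A\<^esub> t \<in> S r" if st: "s \<in> S r" "t \<in> S r" for s t
    proof -
      obtain a b c d where s: "s = \<phi> (v a b)" "real_of_int a + r * real_of_int b > 0"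
        and t: "t = \<phi> (v c d)" "real_of_int c + r * real_of_int d > 0"
        using st by (auto simp: S_def)
      have "s \<otimes>\<^bsub>A\<^esub> t = \<phi> (v (a + c) (b + d))"
        by (simp add: s t v_add)
      moreover have "real_of_int (a + c) + r * real_of_int (b + d) > 0"
        using s t by (simp add: algebra_simps)
      ultimately show ?thesis unfolding S_def by blast
    qed
    obtain M where M: "S r \<subseteq> M" "M \<subseteq> carrier A" "\<And>a. a \<in> M \<Longrightarrow> inv\<^bsub>A\<^esub> a \<notin> M"
      "\<And>a b. a \<in> carrier A \<Longrightarrow> a \<notin> M \<Longrightarrow> b \<in> carrier A \<Longrightarrow> b \<notin> M \<Longrightarrow> a \<otimes>\<^bsub>A\<^esub> b \<notin> M"
      using A.extend_to_strict_cone[OF Ssub Sone Smult] by metis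
    have "\<phi> (v 1 0) \<in> S r" unfolding S_def by force
    then have "conrad_cone G H {h \<in> H. \<phi> h \<in> M}"
      using M(1) by (intro conrad_cone_pullback[OF commA H hom M(2-4) vH[of 1 0]]) auto
    then show ?thesis using M(1) by blast
  qed
  then obtain M where M: "\<And>r. S r \<subseteq> M r" "\<And>r. conrad_cone G H {h \<in> H. \<phi> h \<in> M r}"
    by metis
  define f where "f r = {h \<in> H. \<phi> h \<in> M r}" for r
  have f_neq: "f r \<noteq> f s" if rs: "r < s" for r s
  proof
    assume eq: "f r = f s"
    \<comment> \<open>With q = a/b strictly between r and s, the vector (a, -b) is positive for
      slope r and its negative is positive for slope s. Equal cones would contain both.\<close>
    obtain q :: rat where q: "r < of_rat q" "of_rat q < s"
      using of_rat_dense[OF rs] by blast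
    obtain a b where ab: "q = Fract a b" "b > 0" by (cases q) auto
    have qr: "(of_rat q :: real) = of_int a / of_int b" using ab by (simp add: of_rat_rat)
    have 1: "real_of_int a + r * real_of_int (- b) > 0"
      using q(1) ab(2) by (simp add: qr field_simps)
    have 2: "real_of_int (- a) + s * real_of_int b > 0"
      using q(2) ab(2) by (simp add: qr field_simps)
    have "\<phi> (v a (- b)) \<in> M r" using 1 M(1)[of r] unfolding S_def by blast
    then have "v a (- b) \<in> f r" using vH by (simp add: f_def)
    moreover have "\<phi> (v (- a) b) \<in> M s" using 2 M(1)[of s] unfolding S_def by blast
    then have "v (- a) b \<in> f s" using vH by (simp add: f_def)
    ultimately have in_f: "v a (- b) \<in> f r" "v (- a) b \<in> f r" using eq by auto
    have scone: "strict_cone G H (f r)"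
      using M(2)[of r] conrad_cone.axioms(1) by (auto simp: f_def)
    have "v a (- b) \<otimes> v (- a) b \<in> f r"
      using strict_cone.mult_closed[OF scone] in_f by blast
    \<comment> \<open>As x and y need not commute, the product is only known to be 1 modulo K, and
      membership in \<open>f r\<close> depends on nothing more.\<close>
    moreover have "\<phi> (v a (- b) \<otimes> v (- a) b) = \<phi> \<one>"
      using vH by (simp add: \<phi>_mult v_add) (simp add: v_def)
    then have "\<one> \<in> f r \<longleftrightarrow> v a (- b) \<otimes> v (- a) b \<in> f r"
      using vH subgroup.m_closed[OF H] subgroup.one_closed[OF H] by (simp add: f_def)
    ultimately show False using strict_cone.one_notin[OF scone] by blast
  qed
  then have "inj f"
    by (metis injI linorder_neqE_linordered_idom)
  moreover have "countable (range f)"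
    by (rule countable_subset[OF _ count]) (use M(2) in \<open>auto simp: conrad_cones_def f_def\<close>)
  ultimately have "countable (UNIV :: real set)"
    using countable_image_inj_on by blast
  then show False using uncountable_UNIV_real by blast
qed

end

section \<open>Maximal convex subgroups and their uniqueness\<close>

context strict_cone
begin

text \<open>Q - K is a semigroup disjoint from K. In \<open>same_sign_outside_maximal_convex\<close>
  this yields independence modulo K.\<close>

lemma annulus_powers:
  assumes K: "convex K" and p: "p \<in> Q" "p \<notin> K" and q: "q \<in> Q" "q \<notin> K"
    and mn: "p [^] (m::nat) \<otimes> q [^] (n::nat) \<in> K"
  shows "m = 0 \<and> n = 0"
proof -
  have pow: "r [^] k \<in> Q \<and> r [^] k \<notin> K" if r: "r \<in> Q" "r \<notin> K" and "k > 0" for r and k :: nat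
    using \<open>k > 0\<close>
  proof (induction k)
    case (Suc k)
    then show ?case
      using r annulus_mult_closed[OF K, of "r [^] k" r] by (cases "k = 0") auto
  qed simp
  show ?thesis
    using pow[OF p, of m] pow[OF q, of n] annulus_mult_closed[OF K, of "p [^] m" "q [^] n"] mn p q
    by (cases "m = 0"; cases "n = 0") auto
qed

lemma convex_int_pow:
  assumes K: "convex K" and x: "x \<in> H" "x \<notin> K" and a: "x [^] (a::int) \<in> K"
  shows "a = 0"
proof -
  have nat: "n = 0" if n: "x [^] (n::nat) \<in> K" for n
    using convexD(3)[OF K x]
  proof
    assume "x \<in> Q"
    then show ?thesis using annulus_powers[OF K, of x x n 0] x n by simp
  next
    assume "inv x \<in> Q"
    moreover have "inv x \<notin> K" using x subgroup_inv_iff[OF convexD(1)[OF K], of x] by simp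
    moreover have "inv x [^] n \<in> K"
      using n x subgroup_inv_iff[OF convexD(1)[OF K], of "x [^] n"] by (simp add: nat_pow_inv)
    ultimately show ?thesis using annulus_powers[OF K, of "inv x" "inv x" n 0] x by simp
  qed
  show ?thesis
  proof (cases a rule: int_cases2)
    case (nonneg n)
    then show ?thesis using a nat[of n] by (simp add: int_pow_int)
  next
    case (nonpos n)
    then show ?thesis
      using a x nat[of n] subgroup_inv_iff[OF convexD(1)[OF K], of "x [^] n"]
      by (simp add: int_pow_neg_int)
  qed
qed

end

definition maximal_convex :: "('a, 'b) monoid_scheme \<Rightarrow> 'a set \<Rightarrow> 'a set \<Rightarrow> 'a set \<Rightarrow> bool" where
  "maximal_convex G H Q K \<longleftrightarrow> strict_cone.convex G H Q K \<and> K \<noteq> H \<and>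
     (\<forall>B. strict_cone.convex G H Q B \<and> K \<subset> B \<longrightarrow> B = H)"

context group
begin

text \<open>Otherwise every proper convex subgroup, starting with the residue, has a larger proper
  one, and the resulting ascending chain has infinitely many annuli whose signs can be
  flipped.\<close>

lemma maximal_convex_exists:
  assumes count: "countable (conrad_cones H)" and Q: "conrad_cone G H Q"
  obtains K where "maximal_convex G H Q K"
proof -
  interpret Q: conrad_cone G H Q by (rule Q)
  have "\<exists>K. maximal_convex G H Q K"
  proof (rule ccontr)
    assume none: "\<nexists>K. maximal_convex G H Q K"
    have "\<exists>f. \<forall>n::nat. (Q.convex (f n) \<and> f n \<noteq> H) \<and> f n \<subset> f (Suc n)"
    proof (rule dependent_nat_choice)
      show "\<exists>K. Q.convex K \<and> K \<noteq> H"
        using Q.convex_residue Q.Q_nonempty Q.Q_subset unfolding Q.residue_def by blast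
      show "\<exists>B. (Q.convex B \<and> B \<noteq> H) \<and> K \<subset> B" if "Q.convex K \<and> K \<noteq> H" for K
        using that none unfolding maximal_convex_def by blast
    qed
    then obtain f where "\<forall>n::nat. (Q.convex (f n) \<and> f n \<noteq> H) \<and> f n \<subset> f (Suc n)"
      by (rule exE)
    then have f: "\<And>n. Q.convex (f n)" "\<And>n. f n \<noteq> H" "\<And>n. f n \<subset> f (Suc n)"
      by simp_all
    have mono: "f m \<subseteq> f n" if "m \<le> n" for m n
      using lift_Suc_mono_le[of f, OF psubset_imp_subset[OF f(3)] that] .
    note subf = Q.convexD(1)[OF f(1)] and fH = Q.convexD(2)[OF f(1)]
    \<comment> \<open>The chain need not exhaust H, while the annuli must cover what lies outside
      the smallest subgroup. So the signs are flipped on the union, which is convex and therefore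
      inherits countability.\<close>
    define W where "W = (\<Union>n. f n)"
    have W: "subgroup W G"
    proof (rule subgroupI)
      show "W \<subseteq> carrier G" using subgroup.subset[OF subf] by (auto simp: W_def)
      show "W \<noteq> {}" using subgroup.one_closed[OF subf] by (auto simp: W_def)
      show "inv a \<in> W" if "a \<in> W" for a
        using that subgroup.m_inv_closed[OF subf] by (auto simp: W_def)
      show "a \<otimes> b \<in> W" if ab: "a \<in> W" "b \<in> W" for a b
      proof -
        obtain m n where "a \<in> f m" "b \<in> f n" using ab by (auto simp: W_def)
        then have "a \<in> f (max m n)" "b \<in> f (max m n)"
          using mono[of m "max m n"] mono[of n "max m n"] by auto
        then show ?thesis using subgroup.m_closed[OF subf] by (auto simp: W_def)
      qed
    qed
    have WH: "W \<subseteq> H" using fH by (auto simp: W_def)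
    have convW: "Q.convex W"
      unfolding Q.convex_def
    proof (intro conjI ballI)
      show "a \<in> Q \<or> inv a \<in> Q" if "a \<in> H - W" for a
        using that Q.convexD(3)[OF f(1)[of 0], of a] by (auto simp: W_def)
      show "k \<otimes> a \<in> Q" if "a \<in> Q - W" "k \<in> W" for a k
        using that Q.convexD(4)[OF f(1)] by (auto simp: W_def)
    qed (use W WH in auto)
    have ne: "Q \<inter> f (Suc n) \<noteq> {}" for n
    proof -
      obtain a where a: "a \<in> f (Suc n)" "a \<notin> f n" using f(3)[of n] by blast
      then have "a \<in> Q \<or> inv a \<in> Q" using fH by (intro Q.convexD(3)[OF f(1)]) auto
      then show ?thesis using a subgroup.m_inv_closed[OF subf] by blast
    qed
    have "uncountable (conrad_cones W)"
    proof (rule uncountable_conrad_cones_chain)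
      show "subgroup W G" by (rule W)
      show "conrad_cone G (f (Suc i)) (Q \<inter> f (Suc i))" for i
        by (rule Q.restrict_conrad_cone[OF subf fH ne])
      show "strict_cone.convex G (f (Suc i)) (Q \<inter> f (Suc i)) (f i)" for i
        using f by (intro Q.restrict_convex[OF subf fH ne f(1)]) auto
      show "f i \<noteq> f (Suc i)" for i using f(3)[of i] by blast
      show "f (Suc i) \<subseteq> W" for i by (auto simp: W_def)
      show "f (Suc i) \<subseteq> f j \<or> f (Suc j) \<subseteq> f i" if "i \<noteq> j" for i j
        using that mono[of "Suc i" j] mono[of "Suc j" i] by linarith
      show "(\<forall>i. h \<in> f i) \<or> (\<exists>i. h \<in> f (Suc i) - f i)" if "h \<in> W" for h
      proof (cases "h \<in> f 0")
        case True
        then show ?thesis using mono by blast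
      next
        case False
        obtain n where "h \<in> f n" using \<open>h \<in> W\<close> by (auto simp: W_def)
        then show ?thesis using False by (induction n) auto
      qed
    qed
    then show False
      using countable_conrad_cones_convex[OF count Q convW] by blast
  qed
  then show ?thesis using that by blast
qed

lemma maximal_convex_commutator:
  assumes "conrad_cone G H Q" "maximal_convex G H Q K" "x \<in> H" "y \<in> H"
  shows "inv (y \<otimes> x) \<otimes> (x \<otimes> y) \<in> K"
proof (rule conrad_cone.commutator_in_maximal_convex[OF assms(1) _ _ _ assms(3,4)])
  show "strict_cone.convex G H Q K" "K \<noteq> H"
    using assms(2) by (simp_all add: maximal_convex_def)
  show "B = H" if "strict_cone.convex G H Q B" "K \<subset> B" for B
    using assms(2) that by (simp add: maximal_convex_def)
qed

text \<open>For x in K' but not in K, and y outside K', the pair is independent modulo the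
  intersection of K and K': membership in K' kills the exponent of y, then membership in K kills
  that of x. Both subgroups contain the commutators, so rank two applies.\<close>

lemma maximal_convex_unique:
  assumes count: "countable (conrad_cones H)"
    and Q: "conrad_cone G H Q" "maximal_convex G H Q K"
    and Q': "conrad_cone G H Q'" "maximal_convex G H Q' K'"
  shows "K = K'"
proof -
  have sub: "K' \<subseteq> K" if Q: "conrad_cone G H Q" "maximal_convex G H Q K"
    and Q': "conrad_cone G H Q'" "maximal_convex G H Q' K'" for Q Q' K K'
  proof
    interpret Q: conrad_cone G H Q by (rule Q)
    interpret Q': conrad_cone G H Q' by (rule Q')
    have K: "Q.convex K" and K': "Q'.convex K'" "K' \<noteq> H"
      using Q(2) Q'(2) by (auto simp: maximal_convex_def)
    note sK = Q.convexD(1,2)[OF K] and sK' = Q'.convexD(1,2)[OF K'(1)]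
    fix x assume x: "x \<in> K'"
    obtain y where y: "y \<in> H" "y \<notin> K'" using K'(2) sK'(2) by blast
    have xH: "x \<in> H" using x sK'(2) by blast
    show "x \<in> K"
    proof (rule ccontr)
      assume xK: "x \<notin> K"
      have "uncountable (conrad_cones H)"
      proof (rule uncountable_conrad_cones_rank_two)
        show "subgroup (K \<inter> K') G" using sK(1) sK'(1) by (rule subgroups_Inter_pair)
        show "inv (b \<otimes> a) \<otimes> (a \<otimes> b) \<in> K \<inter> K'" if "a \<in> H" "b \<in> H" for a b
          using that maximal_convex_commutator[OF Q] maximal_convex_commutator[OF Q'] by blast
        show "a = 0 \<and> b = 0" if ab: "x [^] a \<otimes> y [^] b \<in> K \<inter> K'" for a b :: int
        proof -
          have "x [^] a \<in> K'" using subgroup_int_pow_closed[OF sK'(1) x] .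
          then have "y [^] b \<in> K'"
            using ab y subgroup_mult_left_iff[OF sK'(1), of "x [^] a" "y [^] b"] by simp
          then have b: "b = 0" using Q'.convex_int_pow[OF K'(1) y] by blast
          then have "x [^] a \<in> K" using ab xH by simp
          then show ?thesis using Q.convex_int_pow[OF K xH xK] b by blast
        qed
      qed (use Q.subgroup_H sK xH y in auto)
      then show False using count by blast
    qed
  qed
  show ?thesis using sub[OF Q Q'] sub[OF Q' Q] by blast
qed

text \<open>If x and y had equal signs for Q but opposite signs for R, they would be independent
  modulo K: Q excludes relations with exponents of equal sign, R those with exponents of opposite
  sign.\<close>

lemma same_sign_outside_maximal_convex:
  assumes count: "countable (conrad_cones H)"
    and Q: "conrad_cone G H Q" "maximal_convex G H Q K"
    and R: "conrad_cone G H R" "maximal_convex G H R K"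
    and x: "x \<in> Q" "x \<in> R" "x \<notin> K" and y: "y \<in> Q" "y \<notin> K"
  shows "y \<in> R"
proof (rule ccontr)
  interpret Q: conrad_cone G H Q by (rule Q)
  interpret R: conrad_cone G H R by (rule R)
  have K: "Q.convex K" "R.convex K" using Q(2) R(2) by (auto simp: maximal_convex_def)
  note sK = Q.convexD(1,2)[OF K(1)]
  have xy [simp]: "x \<in> H" "y \<in> H" using x y by auto
  assume "y \<notin> R"
  then have iy: "inv y \<in> R" using R.convexD(3)[OF K(2), of y] y by simp
  have iyK: "inv y \<notin> K" using y subgroup_inv_iff[OF sK(1), of y] by simp
  have "uncountable (conrad_cones H)"
  proof (rule uncountable_conrad_cones_rank_two[OF Q.subgroup_H sK])
    show "inv (b \<otimes> a) \<otimes> (a \<otimes> b) \<in> K" if "a \<in> H" "b \<in> H" for a b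
      using that maximal_convex_commutator[OF Q] by blast
    show "a = 0 \<and> b = 0" if ab: "x [^] a \<otimes> y [^] b \<in> K" for a b :: int
    proof -
      \<comment> \<open>The inverted relation turns a nonpositive exponent of x into a natural one.
        It also swaps the factors, so \<open>annulus_powers\<close> is used below with the roles of
        its two elements exchanged.\<close>
      have "inv (x [^] a \<otimes> y [^] b) \<in> K"
        using ab by (rule subgroup.m_inv_closed[OF sK(1)])
      then have ba: "y [^] (- b) \<otimes> x [^] (- a) \<in> K"
        by (simp add: inv_mult_group int_pow_neg)
      show ?thesis
      proof (cases a rule: int_cases2; cases b rule: int_cases2)
        fix m n assume "a = int m" "b = int n"
        then show ?thesis
          using ab Q.annulus_powers[OF K(1) x(1,3) y, of m n] by (simp add: int_pow_int)
      next
        fix m n assume "a = int m" "b = - int n"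
        then show ?thesis
          using ab R.annulus_powers[OF K(2) x(2,3) iy iyK, of m n]
          by (simp add: int_pow_int int_pow_neg_int nat_pow_inv)
      next
        fix m n assume "a = - int m" "b = int n"
        then show ?thesis
          using ba R.annulus_powers[OF K(2) iy iyK x(2,3), of n m]
          by (simp add: int_pow_int int_pow_neg_int nat_pow_inv)
      next
        fix m n assume "a = - int m" "b = - int n"
        then show ?thesis
          using ba Q.annulus_powers[OF K(1) y x(1,3), of n m] by (simp add: int_pow_int)
      qed
    qed
  qed auto
  then show False using count by blast
qed

section \<open>Infinite descent\<close>

text \<open>All cones on H share one maximal convex subgroup K, and outside K the sign of a single x
  fixes the signs of all elements. So a cone is determined by one bit and its trace on K, and
  finitely many cones on K would allow only finitely many on H.\<close>

lemma infinite_conrad_cones_descend: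
  assumes count: "countable (conrad_cones H)" and inf: "infinite (conrad_cones H)"
  shows "\<exists>K Q. conrad_cone G H Q \<and> strict_cone.convex G H Q K \<and> K \<noteq> H \<and>
    countable (conrad_cones K) \<and> infinite (conrad_cones K)"
proof -
  obtain Q where Q: "conrad_cone G H Q"
    using infinite_imp_nonempty[OF inf] by (auto simp: conrad_cones_def)
  obtain K where mQ: "maximal_convex G H Q K"
    using maximal_convex_exists[OF count Q] .
  have mK: "maximal_convex G H R K" if R: "conrad_cone G H R" for R
  proof -
    obtain L where L: "maximal_convex G H R L"
      using maximal_convex_exists[OF count R] .
    then show ?thesis using maximal_convex_unique[OF count R L Q mQ] by simp
  qed
  interpret Q: conrad_cone G H Q by (rule Q)
  have K: "Q.convex K" "K \<noteq> H" using mQ by (auto simp: maximal_convex_def)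
  note sK = Q.convexD(1,2)[OF K(1)]
  obtain x where x: "x \<in> Q" "x \<notin> K" using Q.annulus_nonempty[OF K] .
  then have xH: "x \<in> H" "inv x \<notin> K" using subgroup_inv_iff[OF sK(1), of x] by auto
  have "infinite (conrad_cones K)"
  proof
    assume fin: "finite (conrad_cones K)"
    define g where "g R = (x \<in> R, R \<inter> K)" for R
    \<comment> \<open>The empty trace occurs when the cone makes all elements of K equivalent to
      1.\<close>
    have "g ` conrad_cones H \<subseteq> UNIV \<times> insert {} (conrad_cones K)"
      using conrad_cone.restrict_conrad_cone[OF _ sK] by (auto simp: g_def conrad_cones_def)
    moreover have "finite ((UNIV :: bool set) \<times> insert {} (conrad_cones K))"
      using fin by simp
    moreover have "inj_on g (conrad_cones H)"
    proof (rule inj_onI)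
      have sub: "R \<subseteq> S" if R: "conrad_cone G H R" and S: "conrad_cone G H S" and eq: "g R = g S" for R S
      proof
        interpret R: conrad_cone G H R by (rule R)
        interpret S: conrad_cone G H S by (rule S)
        have "R.convex K" "S.convex K"
          using mK[OF R] mK[OF S] by (auto simp: maximal_convex_def)
        then have "x \<in> R \<and> x \<in> S \<or> inv x \<in> R \<and> inv x \<in> S"
          using R.convexD(3)[of K x] S.convexD(3)[of K x] eq x xH by (auto simp: g_def)
        then obtain z where z: "z \<in> R" "z \<in> S" "z \<notin> K" using x xH by blast
        fix y assume y: "y \<in> R"
        show "y \<in> S"
        proof (cases "y \<in> K")
          case True
          then show ?thesis using eq y by (auto simp: g_def)
        next
          case False
          then show ?thesis
            using same_sign_outside_maximal_convex[OF count R mK[OF R] S mK[OF S] z y] by blast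
        qed
      qed
      fix R S assume "R \<in> conrad_cones H" "S \<in> conrad_cones H" "g R = g S"
      then show "R = S" using sub[of R S] sub[of S R] by (auto simp: conrad_cones_def)
    qed
    ultimately show False using inf inj_on_finite by blast
  qed
  then show ?thesis using Q K countable_conrad_cones_convex[OF count Q K(1)] by blast
qed

text \<open>Each descent step may use a different cone, so the chain consists of subgroups, each
  convex for some cone on its predecessor, and not of convex subgroups of one order on H. Gluing
  accepts such unrelated cones.\<close>

lemma finite_or_uncountable_conrad_cones:
  "finite (conrad_cones H) \<or> uncountable (conrad_cones H)"
proof (rule ccontr)
  assume "\<not> ?thesis"
  then have H: "countable (conrad_cones H)" "infinite (conrad_cones H)" by auto
  \<comment> \<open>The clause for n = 0 makes dependent choice start the chain at H itself.\<close>
  define P where "P n X \<longleftrightarrow> (n = 0 \<longrightarrow> X = H) \<and> countable (conrad_cones X) \<and> infinite (conrad_cones X)"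
    for n :: nat and X
  define step where "step X Y \<longleftrightarrow> (\<exists>Q. conrad_cone G X Q \<and> strict_cone.convex G X Q Y \<and> Y \<noteq> X)"
    for X Y
  have "\<exists>f. \<forall>n. P n (f n) \<and> step (f n) (f (Suc n))"
  proof (rule dependent_nat_choice)
    show "\<exists>X. P 0 X" using H by (auto simp: P_def)
    show "\<exists>Y. P (Suc n) Y \<and> step X Y" if "P n X" for X n
      using infinite_conrad_cones_descend[of X] that unfolding P_def step_def by blast
  qed
  then obtain f where "\<forall>n. P n (f n) \<and> step (f n) (f (Suc n))"
    by (rule exE)
  then have f: "\<And>n. P n (f n)" "\<And>n. step (f n) (f (Suc n))"
    by simp_all
  obtain Q where Q: "\<And>n. conrad_cone G (f n) (Q n)"
    "\<And>n. strict_cone.convex G (f n) (Q n) (f (Suc n))" "\<And>n. f (Suc n) \<noteq> f n"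
    using f(2) unfolding step_def by metis
  have f0: "f 0 = H" using f(1)[of 0] by (simp add: P_def)
  have "f (Suc n) \<subseteq> f n" for n
    using strict_cone.convexD(2)[OF conrad_cone.axioms(1)[OF Q(1)] Q(2)] .
  then have mono: "f n \<subseteq> f m" if "m \<le> n" for m n
    using lift_Suc_antimono_le[of f m n] that by simp
  have "uncountable (conrad_cones H)"
  proof (rule uncountable_conrad_cones_chain[where U = f and Q = Q])
    show "subgroup H G"
      using strict_cone.subgroup_H[OF conrad_cone.axioms(1)[OF Q(1)], of 0] by (simp add: f0)
    show "f i \<subseteq> H" for i using mono[of 0 i] f0 by simp
    show "f i \<subseteq> f (Suc j) \<or> f j \<subseteq> f (Suc i)" if "i \<noteq> j" for i j
      using that mono[of "Suc i" j] mono[of "Suc j" i] by linarith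
    show "(\<forall>i. h \<in> f (Suc i)) \<or> (\<exists>i. h \<in> f i - f (Suc i))" if "h \<in> H" for h
    proof (rule ccontr)
      assume *: "\<not> ?thesis"
      have "h \<in> f n" for n
        using * that f0 by (induction n) auto
      then show False using * by blast
    qed
  qed (rule Q)+
  then show False using H(1) by blast
qed

section \<open>From cones back to preorders\<close>

definition strictly_positive :: "('a \<times> 'a) set \<Rightarrow> 'a set" where
  "strictly_positive r = {a \<in> carrier G. (\<one>, a) \<in> strict_part r}"

text \<open>By totality, being strictly positive is the failure of c \<preceq> 1, and left
  translation by b^-1 reduces a \<preceq> b to a comparison with 1. The positive elements therefore
  determine the preorder.\<close>

lemma left_preorder_strictly_positive:
  assumes r: "left_preorder G r"
  shows "c \<in> strictly_positive r \<longleftrightarrow> c \<in> carrier G \<and> (c, \<one>) \<notin> r"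
    and "a \<in> carrier G \<Longrightarrow> b \<in> carrier G \<Longrightarrow> (a, b) \<in> r \<longleftrightarrow> inv b \<otimes> a \<notin> strictly_positive r"
proof -
  have total: "(a, b) \<in> r \<or> (b, a) \<in> r" if "a \<in> carrier G" "b \<in> carrier G" for a b
    using r that unfolding left_preorder_def total_on_def refl_on_def by metis
  have left: "(c \<otimes> a, c \<otimes> b) \<in> r" if "(a, b) \<in> r" "a \<in> carrier G" "b \<in> carrier G" "c \<in> carrier G" for a b c
    using r that unfolding left_preorder_def by blast
  show pos: "c \<in> strictly_positive r \<longleftrightarrow> c \<in> carrier G \<and> (c, \<one>) \<notin> r" for c
    using total[of c \<one>] by (auto simp: strictly_positive_def strict_part_def)
  assume ab: "a \<in> carrier G" "b \<in> carrier G"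
  then have "(a, b) \<in> r \<longleftrightarrow> (inv b \<otimes> a, \<one>) \<in> r"
    using left[of a b "inv b"] left[of "inv b \<otimes> a" \<one> b] by auto
  then show "(a, b) \<in> r \<longleftrightarrow> inv b \<otimes> a \<notin> strictly_positive r"
    using pos ab by simp
qed

lemma inj_on_strictly_positive: "inj_on strictly_positive (conradian_left_preorders G)"
proof (rule inj_onI)
  fix r s assume "r \<in> conradian_left_preorders G" "s \<in> conradian_left_preorders G"
    and eq: "strictly_positive r = strictly_positive s"
  then have rs: "left_preorder G r" "left_preorder G s"
    by (auto simp: conradian_left_preorders_def)
  then have "r \<subseteq> carrier G \<times> carrier G" "s \<subseteq> carrier G \<times> carrier G"
    by (auto simp: left_preorder_def)
  then show "r = s"
    using left_preorder_strictly_positive(2)[OF rs(1)] left_preorder_strictly_positive(2)[OF rs(2)] eq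
    by auto
qed

lemma strictly_positive_conrad_cone:
  assumes "r \<in> conradian_left_preorders G"
  shows "conrad_cone G (carrier G) (strictly_positive r)"
proof -
  have r: "left_preorder G r" and conr: "conradian G r"
    using assms by (auto simp: conradian_left_preorders_def)
  note pos = left_preorder_strictly_positive[OF r]
  have pos_closed: "a \<in> carrier G" if "a \<in> strictly_positive r" for a
    using that by (simp add: strictly_positive_def)
  have sub: "r \<subseteq> carrier G \<times> carrier G" and ne: "r \<noteq> carrier G \<times> carrier G" and "trans r"
    and total: "total_on (carrier G) r" and refl: "refl_on (carrier G) r"
    using r by (auto simp: left_preorder_def)
  show ?thesis
  proof (rule conrad_coneI)
    show "subgroup (carrier G) G" by (rule subgroup_self)
    show "strictly_positive r \<subseteq> carrier G" using pos_closed by blast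
    obtain a b where "a \<in> carrier G" "b \<in> carrier G" "(a, b) \<notin> r"
      using sub ne by blast
    then show "strictly_positive r \<noteq> {}" using pos(2) by blast
    show "inv a \<notin> strictly_positive r" if "a \<in> strictly_positive r" for a
    proof -
      have a: "a \<in> carrier G" "(a, \<one>) \<notin> r" using that pos(1) by auto
      then have "(\<one>, a) \<in> r"
        using total refl by (metis one_closed refl_on_def total_on_def)
      then show ?thesis using pos(2)[of \<one> a] a by simp
    qed
    show "a \<otimes> b \<notin> strictly_positive r"
      if ab: "a \<in> carrier G" "a \<notin> strictly_positive r" "b \<in> carrier G" "b \<notin> strictly_positive r" for a b
    proof -
      have "(a \<otimes> b, a) \<in> r" "(a, \<one>) \<in> r"
        using ab pos(2)[of "a \<otimes> b" a] pos(1)[of a] by simp_all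
      then have "(a \<otimes> b, \<one>) \<in> r" using \<open>trans r\<close> by (meson transD)
      then show ?thesis using pos(1) by blast
    qed
    show "\<exists>n::nat. inv a \<otimes> (b \<otimes> a [^] n) \<in> strictly_positive r"
      if ab: "a \<in> strictly_positive r" "b \<in> strictly_positive r" for a b
    proof -
      have abc: "a \<in> carrier G" "b \<in> carrier G" using ab pos_closed by auto
      then obtain n :: nat where "(a, b \<otimes> a [^] n) \<in> strict_part r"
        using conr ab by (auto simp: conradian_def strictly_positive_def)
      then have "(b \<otimes> a [^] n, a) \<notin> r" by (simp add: strict_part_def)
      then have "inv a \<otimes> (b \<otimes> a [^] n) \<in> strictly_positive r"
        using pos(2)[of "b \<otimes> a [^] n" a] abc by simp
      then show ?thesis by blast
    qed
  qed
qed

lemma conrad_cone_strictly_positive: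
  assumes Q: "conrad_cone G (carrier G) Q"
  shows "\<exists>r\<in>conradian_left_preorders G. strictly_positive r = Q"
proof -
  interpret Q: conrad_cone G "carrier G" Q by (rule Q)
  \<comment> \<open>Negating the reversed strict relation makes elements of a common residue coset
    equivalent, as required for a preorder that need not be antisymmetric.\<close>
  define r where "r = {(a, b). a \<in> carrier G \<and> b \<in> carrier G \<and> \<not> Q.less b a}"
  have strict: "(a, b) \<in> strict_part r \<longleftrightarrow> a \<in> carrier G \<and> b \<in> carrier G \<and> Q.less a b" for a b
    using Q.less_trans[of a b a] Q.less_irrefl[of a] by (auto simp: strict_part_def r_def)
  have "left_preorder G r"
    unfolding left_preorder_def
  proof (intro conjI ballI impI)
    show "r \<subseteq> carrier G \<times> carrier G" by (auto simp: r_def)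
    show "total_on (carrier G) r"
      using strict by (auto simp: total_on_def strict_part_def r_def)
    show "trans r"
      by (rule transI) (use Q.le_trans in \<open>auto simp: r_def\<close>)
    show "refl_on (carrier G) r"
      using Q.less_irrefl by (auto simp: refl_on_def r_def)
    show "(a \<otimes> a1, a \<otimes> a2) \<in> r"
      if "a \<in> carrier G" "a1 \<in> carrier G" "a2 \<in> carrier G" "(a1, a2) \<in> r" for a a1 a2
      using that Q.less_mult_left by (auto simp: r_def)
    obtain q where q: "q \<in> Q" using Q.Q_nonempty by blast
    then have "(q, \<one>) \<notin> r" using Q.Q_subset by (auto simp: r_def Q.less_def)
    then show "r \<noteq> carrier G \<times> carrier G" using q Q.Q_subset by blast
  qed
  moreover have "conradian G r"
    unfolding conradian_def strict using Q.conrad by (auto simp: Q.less_def)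
  moreover have "strictly_positive r = Q"
    unfolding strictly_positive_def strict using Q.Q_subset by (auto simp: Q.less_def)
  ultimately show ?thesis by (auto simp: conradian_left_preorders_def)
qed

end

theorem corollary1p3:
  fixes G :: "('a, 'b) monoid_scheme"
  assumes "group G"
  shows "finite (conradian_left_preorders G) \<or> uncountable (conradian_left_preorders G)"
proof -
  interpret group G by (rule assms)
  have "strictly_positive ` conradian_left_preorders G = conrad_cones (carrier G)"
    using strictly_positive_conrad_cone conrad_cone_strictly_positive
    by (fastforce simp: conrad_cones_def)
  then show ?thesis
    using finite_or_uncountable_conrad_cones[of "carrier G"]
      finite_image_iff[OF inj_on_strictly_positive] countable_image_inj_eq[OF inj_on_strictly_positive]
    by metis
qed

end
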